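(* Let $K=\langle a,b\mid b^{-1}ab=a^{-1}\rangle$ be the fundamental group of the Klein bottle. Then: (i) There exists a finitely generated group $G$ containing $K$ as a verbally closed subgroup such that $K$ is not a retract of $G$. (ii) For every finitely generated group $G$ containing $K$ as a verbally closed subgroup, there exists a subgroup $L\le G$ with $K\le L$ and $[G:L]\le 2$ such that $K$ is a retract of $L$.
   Context: A subgroup $H$ of a group $G$ is called verbally closed in $G$ if for every $n$, every element $w(x_1,\dots,x_n)$ of the free group $F(x_1,\dots,x_n)$ and every $h\in H$ the following holds: if there exist $g_1,\dots,g_n\in G$ with $w(g_1,\dots,g_n)=h$, then there exist $h_1,\dots,h_n\in H$ with $w(h_1,\dots,h_n)=h$. A subgroup $H$ of a group $L$ is a retract of $L$ if there is a homomorphism $\rho:L\to H$ with $\rho(h)=h$ for all $h\in H$ (equivalently, $H$ is the image of an endomorphism $\rho$ of $L$ with $\rho\circ\rho=\rho$). *)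

theory Defs
  imports "HOL-Algebra.Algebra"
begin

text \<open>Concrete model of the Klein bottle group K = < a, b | b^-1 a b = a^-1 >.
  The element (m, n) stands for the normal form a^m b^n; since b^n a^m = a^((-1)^n m) b^n,
  the product is a^m1 b^n1 a^m2 b^n2 = a^(m1 + (-1)^n1 m2) b^(n1 + n2).
  Here a = (1,0), b = (0,1).\<close>
definition klein_group :: "(int \<times> int) monoid" where
  "klein_group = \<lparr> carrier = UNIV,
     monoid.mult = (\<lambda>(m1, n1) (m2, n2). (m1 + (if even n1 then m2 else - m2), n1 + n2)),
     one = (0, 0) \<rparr>"

text \<open>Words of the free group F(x_0, x_1, ...): a list of letters (i, True) = x_i and
  (i, False) = x_i^-1. Every element of a free group is represented by such a word, and
  the value of a word under a substitution only depends on the represented element.\<close>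
type_synonym word = "(nat \<times> bool) list"

definition word_eval :: "('a, 'b) monoid_scheme \<Rightarrow> (nat \<Rightarrow> 'a) \<Rightarrow> word \<Rightarrow> 'a" where
  "word_eval G g w =
     foldr (\<lambda>(i, e) acc. (if e then g i else inv\<^bsub>G\<^esub> (g i)) \<otimes>\<^bsub>G\<^esub> acc) w \<one>\<^bsub>G\<^esub>"

definition verbally_closed :: "('a, 'b) monoid_scheme \<Rightarrow> 'a set \<Rightarrow> bool" where
  "verbally_closed G H \<longleftrightarrow> subgroup H G \<and>
     (\<forall>(n::nat) (w::word) h. set (map fst w) \<subseteq> {..<n} \<longrightarrow> h \<in> H \<longrightarrow>
        (\<exists>g. (\<forall>i<n. g i \<in> carrier G) \<and> word_eval G g w = h) \<longrightarrow>
        (\<exists>g. (\<forall>i<n. g i \<in> H) \<and> word_eval G g w = h))"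

definition is_retract :: "('a, 'b) monoid_scheme \<Rightarrow> 'a set \<Rightarrow> bool" where
  "is_retract L H \<longleftrightarrow> subgroup H L \<and>
     (\<exists>\<rho> \<in> hom L (L\<lparr>carrier := H\<rparr>). \<forall>h\<in>H. \<rho> h = h)"

definition finitely_generated :: "('a, 'b) monoid_scheme \<Rightarrow> bool" where
  "finitely_generated G \<longleftrightarrow> (\<exists>S. finite S \<and> S \<subseteq> carrier G \<and> generate G S = carrier G)"

lemma klein_group_is_group: "group klein_group"
proof (rule groupI)
  fix x y z assume "x \<in> carrier klein_group" "y \<in> carrier klein_group" "z \<in> carrier klein_group"
  show "x \<otimes>\<^bsub>klein_group\<^esub> y \<otimes>\<^bsub>klein_group\<^esub> z =
        x \<otimes>\<^bsub>klein_group\<^esub> (y \<otimes>\<^bsub>klein_group\<^esub> z)"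
    by (cases x; cases y; cases z) (auto simp: klein_group_def)
next
  fix x assume "x \<in> carrier klein_group"
  show "\<exists>y\<in>carrier klein_group. y \<otimes>\<^bsub>klein_group\<^esub> x = \<one>\<^bsub>klein_group\<^esub>"
    by (cases x) (rule bexI[where x="(if even (snd x) then - fst x else fst x, - snd x)"],
        auto simp: klein_group_def)
qed (auto simp: klein_group_def)

end

theory Submission
  imports Defs
begin

text \<open>
  The Klein bottle group \<open>K\<close> is the fibre product of the infinite dihedral group and \<open>\<int>\<close> over
  \<open>\<int>/2\<close>, so a homomorphism \<open>F \<rightarrow> K\<close> from a free group is a pair of a homomorphism \<open>f : F \<rightarrow> \<int>\<close>
  and a crossed homomorphism \<open>c : F \<rightarrow> \<int>\<close> twisted by the sign character \<open>f mod 2\<close>.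

  For the positive part, let \<open>R\<close> be the relators of \<open>G\<close>. If for every sign character \<open>\<epsilon>\<close> of \<open>F\<close> no
  \<open>\<epsilon>\<close>-crossed homomorphism kills \<open>R\<close> and takes the value \<open>1\<close> at \<open>a\<close>, then for each \<open>\<epsilon>\<close> some relator
  exhibits \<open>N a\<close> as divisible by \<open>N p\<close> with \<open>p > 1\<close>. Averaging conjugates against \<open>\<epsilon>\<close> makes such
  relators invisible to the other signs, so their product is one relator \<open>r\<close> for which
  \<open>a\<^sup>m r = a\<^sup>m\<close> has no solution in \<open>K\<close>. Hence \<open>G\<close> maps to the dihedral group with some sign \<open>\<epsilon>\<close>,
  and similarly to \<open>\<int>\<close> by some \<open>f\<close>; the two combine to a retraction wherever \<open>\<epsilon>\<close> agrees with
  \<open>f mod 2\<close>, which is a subgroup of index at most two.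

  For the negative part, take \<open>\<int>\<^sup>3\<close> extended by three signs whose product is the parity of an extra
  integer coordinate. The three subgroups where one sign agrees with the parity cover the group,
  which makes \<open>K\<close> verbally closed, although no single sign works on the whole group.
\<close>

section \<open>Words and crossed homomorphisms\<close>

definition words :: "nat \<Rightarrow> word set" where
  "words s = {w. fst ` set w \<subseteq> {..<s}}"

definition word_inv :: "word \<Rightarrow> word" where
  "word_inv w = rev (map (\<lambda>(i, e). (i, \<not> e)) w)"

fun word_sign :: "(nat \<Rightarrow> int) \<Rightarrow> word \<Rightarrow> int" where
  "word_sign \<epsilon> [] = 1"
| "word_sign \<epsilon> ((i, e) # w) = \<epsilon> i * word_sign \<epsilon> w"

text \<open>The value at a word of the \<open>\<epsilon>\<close>-crossed homomorphism that takes the value \<open>c i\<close> at the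
  \<open>i\<close>-th generator; for a unit vector \<open>c\<close> this is a Fox derivative evaluated at \<open>\<epsilon>\<close>.\<close>

fun word_cross :: "(nat \<Rightarrow> int) \<Rightarrow> (nat \<Rightarrow> int) \<Rightarrow> word \<Rightarrow> int" where
  "word_cross \<epsilon> c [] = 0"
| "word_cross \<epsilon> c ((i, e) # w) = (if e then c i else - \<epsilon> i * c i) + \<epsilon> i * word_cross \<epsilon> c w"

definition unit_vec :: "nat \<Rightarrow> nat \<Rightarrow> int" where
  "unit_vec i = (\<lambda>j. if j = i then 1 else 0)"

lemma unit_vec_commute: "unit_vec i j = unit_vec j i"
  by (simp add: unit_vec_def)

lemma Nil_in_words [simp]: "[] \<in> words s"
  by (simp add: words_def)

lemma Cons_in_words [simp]: "(i, e) # w \<in> words s \<longleftrightarrow> i < s \<and> w \<in> words s"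
  by (auto simp: words_def)

lemma append_in_words [simp]: "u @ v \<in> words s \<longleftrightarrow> u \<in> words s \<and> v \<in> words s"
  by (auto simp: words_def)

lemma word_inv_in_words [simp]: "word_inv w \<in> words s \<longleftrightarrow> w \<in> words s"
  by (force simp: words_def word_inv_def)

lemma replicate_in_words [simp]: "i < s \<Longrightarrow> replicate n (i, e) \<in> words s"
  by (auto simp: words_def)

lemma word_inv_Nil [simp]: "word_inv [] = []"
  by (simp add: word_inv_def)

lemma word_inv_Cons [simp]: "word_inv ((i, e) # w) = word_inv w @ [(i, \<not> e)]"
  by (simp add: word_inv_def)

lemma words_induct [consumes 1, case_names Nil Cons]:
  assumes "w \<in> words s" and "P []"
    and "\<And>i e w. i < s \<Longrightarrow> w \<in> words s \<Longrightarrow> P w \<Longrightarrow> P ((i, e) # w)"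
  shows "P w"
  using assms(1)
proof (induction w)
  case Nil
  show ?case by (rule assms(2))
next
  case (Cons x w)
  then show ?case using assms(3) by (cases x) auto
qed

lemma word_sign_append [simp]: "word_sign \<epsilon> (u @ v) = word_sign \<epsilon> u * word_sign \<epsilon> v"
  by (induction u) auto

lemma word_cross_append [simp]:
  "word_cross \<epsilon> c (u @ v) = word_cross \<epsilon> c u + word_sign \<epsilon> u * word_cross \<epsilon> c v"
  by (induction u) (auto simp: algebra_simps)

lemma word_sign_inv [simp]: "word_sign \<epsilon> (word_inv w) = word_sign \<epsilon> w"
  by (induction w) auto

lemma word_sign_cases:
  assumes "\<And>i. \<epsilon> i \<in> {1, -1}"
  shows "word_sign \<epsilon> w \<in> {1, -1}"
proof (induction w)
  case (Cons x w)
  then show ?case using assms[of "fst x"] by (cases x) auto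
qed simp

lemma word_sign_square:
  assumes "\<And>i. \<epsilon> i \<in> {1, -1}"
  shows "word_sign \<epsilon> w * word_sign \<epsilon> w = 1"
  using word_sign_cases[of \<epsilon> w] assms by auto

lemma word_cross_inv:
  assumes "\<And>i. \<epsilon> i \<in> {1, -1}"
  shows "word_cross \<epsilon> c (word_inv w) = - word_sign \<epsilon> w * word_cross \<epsilon> c w"
proof (induction w)
  case (Cons x w)
  obtain i e where x: "x = (i, e)" by (cases x)
  show ?case using Cons assms[of i] by (auto simp: x algebra_simps)
qed simp

lemma word_sign_one [simp]: "word_sign (\<lambda>_. 1) w = 1"
  by (induction w) auto

lemma word_cross_cong:
  assumes "w \<in> words s" "\<And>i. i < s \<Longrightarrow> \<epsilon> i = \<epsilon>' i" "\<And>i. i < s \<Longrightarrow> c i = c' i"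
  shows "word_cross \<epsilon> c w = word_cross \<epsilon>' c' w"
  using assms(1) by (induction rule: words_induct) (auto simp: assms(2,3))

text \<open>The coefficients are the Fox derivatives of \<open>w\<close> evaluated at
  \<open>\<epsilon>\<close>. Every later divisibility argument reduces to them, since only unit
  vectors need checking.\<close>

lemma word_cross_linear:
  assumes "w \<in> words s"
  shows "word_cross \<epsilon> c w = (\<Sum>i<s. c i * word_cross \<epsilon> (unit_vec i) w)"
  using assms
proof (induction rule: words_induct)
  case (Cons k e w)
  have "(\<Sum>i<s. c i * word_cross \<epsilon> (unit_vec i) ((k, e) # w)) =
      (\<Sum>i<s. (if i = k then (if e then c k else - \<epsilon> k * c k) else 0)
              + \<epsilon> k * (c i * word_cross \<epsilon> (unit_vec i) w))"
    by (rule sum.cong) (auto simp: unit_vec_def algebra_simps)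
  also have "\<dots> = (if e then c k else - \<epsilon> k * c k)
      + \<epsilon> k * (\<Sum>i<s. c i * word_cross \<epsilon> (unit_vec i) w)"
    using Cons.hyps by (simp add: sum.distrib sum_distrib_left)
  finally show ?case using Cons.IH by simp
qed simp

lemma word_cross_dvd:
  assumes "w \<in> words s" "\<And>i. i < s \<Longrightarrow> d dvd word_cross \<epsilon> (unit_vec i) w"
  shows "d dvd word_cross \<epsilon> c w"
  by (subst word_cross_linear[OF assms(1)], rule dvd_sum) (use assms(2) in auto)

lemma word_cross_replicate_one:
  assumes "\<epsilon> i = 1"
  shows "word_cross \<epsilon> c (replicate n (i, True)) = int n * c i"
  by (induction n) (auto simp: assms algebra_simps)

lemma word_sign_replicate_one:
  assumes "\<epsilon> i = 1"
  shows "word_sign \<epsilon> (replicate n (i, True)) = 1"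
  by (induction n) (auto simp: assms)

text \<open>A generator of sign -1 acts as a reflection, so its square is invisible to every crossed
  homomorphism.\<close>

lemma word_cross_replicate_minus_one:
  assumes "\<epsilon> i = -1"
  shows "word_cross \<epsilon> c (replicate (2 * n) (i, True)) = 0"
    and "word_sign \<epsilon> (replicate (2 * n) (i, True)) = 1"
  by (induction n) (auto simp: assms)

lemma word_eval_Nil [simp]: "word_eval G g [] = \<one>\<^bsub>G\<^esub>"
  by (simp add: word_eval_def)

lemma word_eval_Cons [simp]:
  "word_eval G g ((i, e) # w) = (if e then g i else inv\<^bsub>G\<^esub> (g i)) \<otimes>\<^bsub>G\<^esub> word_eval G g w"
  by (simp add: word_eval_def)

lemma word_eval_cong:
  assumes "w \<in> words s" "\<And>i. i < s \<Longrightarrow> g i = g' i"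
  shows "word_eval G g w = word_eval G g' w"
  using assms(1) by (induction rule: words_induct) (auto simp: assms(2))

lemma (in group) word_eval_closed:
  assumes "w \<in> words s" "\<And>i. i < s \<Longrightarrow> g i \<in> carrier G"
  shows "word_eval G g w \<in> carrier G"
  using assms(1) by (induction rule: words_induct) (auto simp: assms(2))

lemma (in group) word_eval_append:
  assumes "u \<in> words s" "v \<in> words s" "\<And>i. i < s \<Longrightarrow> g i \<in> carrier G"
  shows "word_eval G g (u @ v) = word_eval G g u \<otimes> word_eval G g v"
  using assms(1)
  by (induction rule: words_induct) (auto simp: assms(2,3) m_assoc word_eval_closed[of _ s])

lemma (in group) word_eval_inv:
  assumes "w \<in> words s" "\<And>i. i < s \<Longrightarrow> g i \<in> carrier G"
  shows "word_eval G g (word_inv w) = inv (word_eval G g w)"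
  using assms(1)
proof (induction rule: words_induct)
  case (Cons i e w)
  then show ?case
    by (auto simp: word_eval_append[of _ s] word_eval_closed[of _ s] assms(2) inv_mult_group)
qed simp

lemma word_eval_hom:
  assumes "group G" "group H" "h \<in> hom G H"
    and "w \<in> words s" "\<And>i. i < s \<Longrightarrow> g i \<in> carrier G"
  shows "word_eval H (\<lambda>i. h (g i)) w = h (word_eval G g w)"
proof -
  interpret group_hom G H h
    using assms(1-3) by (simp add: group_hom_def group_hom_axioms_def)
  show ?thesis
    using assms(4) by (induction rule: words_induct) (auto simp: assms(5) G.word_eval_closed[of _ s])
qed

section \<open>Words evaluated in the Klein bottle group\<close>

definition parity_sign :: "int \<Rightarrow> int" where
  "parity_sign n = (if even n then 1 else -1)"

lemma parity_sign_add: "parity_sign (m + n) = parity_sign m * parity_sign n"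
  by (simp add: parity_sign_def)

lemma klein_carrier [simp]: "carrier klein_group = UNIV"
  by (simp add: klein_group_def)

lemma klein_one: "\<one>\<^bsub>klein_group\<^esub> = (0, 0)"
  by (simp add: klein_group_def)

lemma klein_mult:
  "(m, n) \<otimes>\<^bsub>klein_group\<^esub> (m', n') = (m + parity_sign n * m', n + n')"
  by (simp add: klein_group_def parity_sign_def)

lemma klein_inv: "inv\<^bsub>klein_group\<^esub> (m, n) = (- parity_sign n * m, - n)"
  by (rule group.inv_equality[OF klein_group_is_group])
    (auto simp: klein_mult klein_one parity_sign_def)

text \<open>The second coordinate is additive and the first is crossed by its parity. Once the
  parities of the unknowns are fixed, an equation in the Klein bottle group becomes two linear
  equations over the integers.\<close>

lemma word_eval_klein:
  "word_eval klein_group k w =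
    (word_cross (\<lambda>i. parity_sign (snd (k i))) (\<lambda>i. fst (k i)) w,
     word_cross (\<lambda>_. 1) (\<lambda>i. snd (k i)) w)"
proof (induction w)
  case (Cons x w)
  obtain i e where x: "x = (i, e)" by (cases x)
  obtain m n where k: "k i = (m, n)" by (cases "k i")
  show ?case using Cons by (auto simp: x k klein_mult klein_inv parity_sign_def)
qed (simp add: klein_one)

text \<open>Extended Euclid, one index at a time: the coefficients found so far are rescaled by the
  Bezout factor of the old gcd. No sign of \<open>g\<close> is promised, and \<open>g = 0\<close> is
  allowed.\<close>

lemma int_bezout_family:
  fixes e :: "'i \<Rightarrow> int"
  assumes "finite I"
  obtains g u where "(\<Sum>i\<in>I. e i * u i) = g" "\<And>i. i \<in> I \<Longrightarrow> g dvd e i"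
proof -
  have "\<exists>g u. (\<Sum>i\<in>I. e i * u i) = g \<and> (\<forall>i\<in>I. g dvd e i)"
    using assms
  proof (induction I rule: finite_induct)
    case (insert j I)
    then obtain g u where gu: "(\<Sum>i\<in>I. e i * u i) = g" "\<forall>i\<in>I. g dvd e i" by blast
    obtain p q where pq: "p * e j + q * g = gcd (e j) g" using bezout_int by blast
    define u' where "u' = (\<lambda>i. if i = j then p else q * u i)"
    have "(\<Sum>i\<in>I. e i * u' i) = (\<Sum>i\<in>I. q * (e i * u i))"
      using insert.hyps by (intro sum.cong) (auto simp: u'_def)
    also have "\<dots> = q * g" by (simp add: gu(1) flip: sum_distrib_left)
    finally have "(\<Sum>i\<in>insert j I. e i * u' i) = gcd (e j) g"
      using insert.hyps pq by (simp add: u'_def mult.commute)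
    moreover have "\<forall>i\<in>insert j I. gcd (e j) g dvd e i"
      using gu(2) by (auto intro: dvd_trans[OF gcd_dvd2])
    ultimately show ?case by blast
  qed auto
  then show ?thesis using that by blast
qed

section \<open>Integral functionals on lattices\<close>

definition int_subgroup :: "(nat \<Rightarrow> int) set \<Rightarrow> bool" where
  "int_subgroup A \<longleftrightarrow> (\<lambda>_. 0) \<in> A \<and> (\<forall>x\<in>A. \<forall>y\<in>A. (\<lambda>k. x k - y k) \<in> A)"

lemma int_subgroup_diff:
  "int_subgroup A \<Longrightarrow> x \<in> A \<Longrightarrow> y \<in> A \<Longrightarrow> (\<lambda>k. x k - y k) \<in> A"
  by (auto simp: int_subgroup_def)

lemma int_subgroup_add:
  assumes "int_subgroup A" "x \<in> A" "y \<in> A"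
  shows "(\<lambda>k. x k + y k) \<in> A"
proof -
  have "(\<lambda>k. 0 - y k) \<in> A"
    using assms by (auto simp: int_subgroup_def)
  then have "(\<lambda>k. x k - (0 - y k)) \<in> A"
    using int_subgroup_diff[OF assms(1,2)] by blast
  then show ?thesis by simp
qed

lemma int_subgroup_scale:
  fixes n :: int
  assumes "int_subgroup A" "x \<in> A"
  shows "(\<lambda>k. n * x k) \<in> A"
proof (induction n rule: int_induct[where k = 0])
  case base
  then show ?case using assms(1) by (simp add: int_subgroup_def)
next
  case (step1 i)
  then show ?case using int_subgroup_add[OF assms(1) step1(2) assms(2)] by (simp add: algebra_simps)
next
  case (step2 i)
  then show ?case using int_subgroup_diff[OF assms(1) step2(2) assms(2)] by (simp add: algebra_simps)
qed

lemma int_subgroup_sum: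
  assumes "int_subgroup A" "finite I" "\<And>i. i \<in> I \<Longrightarrow> x i \<in> A"
  shows "(\<lambda>k. \<Sum>i\<in>I. n i * x i k) \<in> A"
  using assms(2,3)
proof (induction I rule: finite_induct)
  case empty
  then show ?case using assms(1) by (simp add: int_subgroup_def)
next
  case (insert i I)
  then show ?case
    using int_subgroup_add[OF assms(1) int_subgroup_scale[OF assms(1), of "x i" "n i"]] by simp
qed

text \<open>These are the pure subgroups, those with torsion-free quotient.\<close>

definition saturated :: "(nat \<Rightarrow> int) set \<Rightarrow> bool" where
  "saturated S \<longleftrightarrow> int_subgroup S \<and> (\<forall>n x. n \<noteq> 0 \<longrightarrow> (\<lambda>k. n * x k) \<in> S \<longrightarrow> x \<in> S)"

text \<open>Generation of the quotient by \<open>S\<close>, phrased with representatives so that no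
  quotient group has to be built.\<close>

definition spans_mod :: "(nat \<Rightarrow> int) set \<Rightarrow> nat set \<Rightarrow> (nat \<Rightarrow> nat \<Rightarrow> int) \<Rightarrow> bool" where
  "spans_mod S I y \<longleftrightarrow> (\<forall>x. \<exists>n. (\<lambda>k. x k - (\<Sum>i\<in>I. n i * y i k)) \<in> S)"

text \<open>Coefficients and vectors change by mutually inverse elementary matrices, so the two
  changes cancel.\<close>

lemma sum_transvection:
  fixes n :: "nat \<Rightarrow> int" and y :: "nat \<Rightarrow> nat \<Rightarrow> int"
  assumes "finite I" "i \<in> I" "j \<in> I" "i \<noteq> j"
  shows "(\<Sum>l\<in>I. (n(i := n i - \<eta> * n j)) l * (y(j := \<lambda>k. y j k + \<eta> * y i k)) l k) =
         (\<Sum>l\<in>I. n l * y l k)"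
proof -
  have *: "(\<Sum>l\<in>I. f l) = f i + f j + (\<Sum>l\<in>I - {i} - {j}. f l)" for f :: "nat \<Rightarrow> int"
    using assms by (simp add: sum.remove[of I i] sum.remove[of "I - {i}" j])
  show ?thesis
    unfolding * using assms(4) by (auto simp: algebra_simps intro!: sum.cong)
qed

text \<open>Euclid's algorithm: transvections shrink the coefficients of a relation until only one
  survives, and saturation then makes the corresponding generator superfluous.\<close>

lemma spans_mod_shrink:
  assumes "saturated S" "finite I" "spans_mod S I y"
    and "(\<lambda>k. \<Sum>i\<in>I. n i * y i k) \<in> S" "i0 \<in> I" "n i0 \<noteq> 0"
  shows "\<exists>i\<in>I. \<exists>y'. spans_mod S (I - {i}) y'"
  using assms(3-6)
proof (induction "\<Sum>i\<in>I. nat \<bar>n i\<bar>" arbitrary: n y i0 rule: less_induct)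
  case less
  have S: "int_subgroup S" using assms(1) by (simp add: saturated_def)
  show ?case
  proof (cases "\<forall>j\<in>I. j \<noteq> i0 \<longrightarrow> n j = 0")
    case True
    have "(\<Sum>i\<in>I. n i * y i k) = n i0 * y i0 k" for k
    proof -
      have "(\<Sum>i\<in>I - {i0}. n i * y i k) = 0" using True by (intro sum.neutral) auto
      then show ?thesis using less.prems(3) assms(2) by (simp add: sum.remove[of I i0])
    qed
    then have y0: "y i0 \<in> S"
      using less.prems(2,4) assms(1) by (auto simp: saturated_def)
    have "spans_mod S (I - {i0}) y"
      unfolding spans_mod_def
    proof
      fix x
      obtain m where m: "(\<lambda>k. x k - (\<Sum>i\<in>I. m i * y i k)) \<in> S"
        using less.prems(1) by (auto simp: spans_mod_def)
      have "(\<lambda>k. (x k - (\<Sum>i\<in>I. m i * y i k)) + m i0 * y i0 k) \<in> S"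
        by (rule int_subgroup_add[OF S m int_subgroup_scale[OF S y0]])
      moreover have "(x k - (\<Sum>i\<in>I. m i * y i k)) + m i0 * y i0 k
          = x k - (\<Sum>i\<in>I - {i0}. m i * y i k)" for k
        using less.prems(3) assms(2) by (simp add: sum.remove[of I i0])
      ultimately show "\<exists>n. (\<lambda>k. x k - (\<Sum>i\<in>I - {i0}. n i * y i k)) \<in> S" by auto
    qed
    then show ?thesis using less.prems(3) by blast
  next
    case False
    then obtain j0 where j0: "j0 \<in> I" "j0 \<noteq> i0" "n j0 \<noteq> 0" by blast
    obtain i j where ij: "i \<in> I" "j \<in> I" "i \<noteq> j" "n i \<noteq> 0" "n j \<noteq> 0" "\<bar>n j\<bar> \<le> \<bar>n i\<bar>"
    proof (cases "\<bar>n j0\<bar> \<le> \<bar>n i0\<bar>")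
      case True
      then show ?thesis using that[of i0 j0] j0 less.prems(3,4) by auto
    next
      case False
      then show ?thesis using that[of j0 i0] j0 less.prems(3,4) by auto
    qed
    \<comment> \<open>The sign is chosen so that the larger coefficient loses exactly the absolute
      value of the smaller one, which makes the induction measure drop.\<close>
    define \<eta> where "\<eta> = sgn (n i * n j)"
    define n' where "n' = n(i := n i - \<eta> * n j)"
    define y' where "y' = y(j := \<lambda>k. y j k + \<eta> * y i k)"
    have abs: "\<bar>n i - \<eta> * n j\<bar> = \<bar>n i\<bar> - \<bar>n j\<bar>"
      using ij(4-6) unfolding \<eta>_def by (auto simp: sgn_if zero_less_mult_iff)
    have "(\<Sum>l\<in>I. nat \<bar>n' l\<bar>) < (\<Sum>l\<in>I. nat \<bar>n l\<bar>)"
      by (rule sum_strict_mono_ex1[OF assms(2)]) (use ij abs in \<open>auto simp: n'_def\<close>)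
    moreover have "spans_mod S I y'"
      unfolding spans_mod_def
    proof
      fix x
      obtain m where m: "(\<lambda>k. x k - (\<Sum>i\<in>I. m i * y i k)) \<in> S"
        using less.prems(1) by (auto simp: spans_mod_def)
      then have "(\<lambda>k. x k - (\<Sum>l\<in>I. (m(i := m i - \<eta> * m j)) l * y' l k)) \<in> S"
        unfolding y'_def sum_transvection[OF assms(2) ij(1-3)] .
      then show "\<exists>m. (\<lambda>k. x k - (\<Sum>i\<in>I. m i * y' i k)) \<in> S" by blast
    qed
    moreover have "(\<lambda>k. \<Sum>l\<in>I. n' l * y' l k) \<in> S"
      unfolding n'_def y'_def sum_transvection[OF assms(2) ij(1-3)] by (rule less.prems(2))
    ultimately show ?thesis
      using less.hyps[of n' y' j] ij(2,3,5) by (auto simp: n'_def)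
  qed
qed

text \<open>A finitely generated torsion-free abelian group is free: a generating family with a
  nontrivial relation can be shortened, so shortening ends at an independent one.\<close>

lemma saturated_complement_basis:
  assumes "saturated S" "finite I" "spans_mod S I y"
  shows "\<exists>J z. finite J \<and> spans_mod S J z \<and>
      (\<forall>n. (\<lambda>k. \<Sum>i\<in>J. n i * z i k) \<in> S \<longrightarrow> (\<forall>i\<in>J. n i = 0))"
  using assms(2,3)
proof (induction "card I" arbitrary: I y rule: less_induct)
  case less
  show ?case
  proof (cases "\<forall>n. (\<lambda>k. \<Sum>i\<in>I. n i * y i k) \<in> S \<longrightarrow> (\<forall>i\<in>I. n i = 0)")
    case True
    then show ?thesis using less.prems by blast
  next
    case False
    then obtain n i0 where n: "(\<lambda>k. \<Sum>i\<in>I. n i * y i k) \<in> S" "i0 \<in> I" "n i0 \<noteq> 0"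
      by auto
    obtain i y' where "i \<in> I" "spans_mod S (I - {i}) y'"
      using spans_mod_shrink[OF assms(1) less.prems n] by auto
    then show ?thesis
      by (intro less.hyps[of "I - {i}" y'])
        (use less.prems(1) card_Diff1_less[of I i] in \<open>auto simp del: card_Diff_insert\<close>)
  qed
qed

text \<open>Modulo the saturation of \<open>A\<close> the lattice is free. If the coordinates of
  \<open>v\<close> there are coprime, Bezout yields the functional; otherwise \<open>v\<close> is
  divisible by some \<open>p > 1\<close> modulo the saturation, and clearing the denominator
  \<open>N\<close> lands in \<open>A\<close>.\<close>

lemma integer_functional_or_obstruction:
  assumes "int_subgroup A"
  obtains
    (functional) l where "\<And>x. x \<in> A \<Longrightarrow> (\<Sum>k<s. l k * x k) = 0" "(\<Sum>k<s. l k * v k) = 1"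
  | (obstruction) N p x where "N > 0" "p > 1" "x \<in> A"
      "\<And>k. k < s \<Longrightarrow> N * p dvd N * v k - x k"
proof -
  \<comment> \<open>The saturation of \<open>A\<close>, with all entries from index \<open>s\<close>
    on disregarded.\<close>
  define S where "S = {x. \<exists>N>0. \<exists>\<alpha>\<in>A. \<forall>k<s. N * x k = \<alpha> k}"
  have zero: "x \<in> S" if "\<And>k. k < s \<Longrightarrow> x k = 0" for x
    using that assms unfolding S_def int_subgroup_def by (auto intro!: exI[of _ 1] bexI[of _ "\<lambda>_. 0"])
  have "int_subgroup S"
    unfolding int_subgroup_def
  proof (intro conjI ballI)
    fix x y assume "x \<in> S" "y \<in> S"
    then obtain M \<alpha> N \<beta> where M: "M > 0" "\<alpha> \<in> A" "\<forall>k<s. M * x k = \<alpha> k"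
      and N: "N > 0" "\<beta> \<in> A" "\<forall>k<s. N * y k = \<beta> k"
      unfolding S_def by blast
    have "(\<lambda>k. N * \<alpha> k - M * \<beta> k) \<in> A"
      by (rule int_subgroup_diff[OF assms int_subgroup_scale[OF assms M(2)]
            int_subgroup_scale[OF assms N(2)]])
    moreover have "\<forall>k<s. (M * N) * (x k - y k) = N * \<alpha> k - M * \<beta> k"
    proof (intro allI impI)
      fix k assume "k < s"
      then have "\<alpha> k = M * x k" "\<beta> k = N * y k" using M(3) N(3) by auto
      then show "(M * N) * (x k - y k) = N * \<alpha> k - M * \<beta> k" by (simp add: algebra_simps)
    qed
    ultimately show "(\<lambda>k. x k - y k) \<in> S"
      unfolding S_def using M(1) N(1) by (auto intro!: exI[of _ "M * N"])
  qed (rule zero, simp)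
  moreover have "x \<in> S" if n: "n \<noteq> 0" "(\<lambda>k. n * x k) \<in> S" for n x
  proof -
    obtain M \<alpha> where M: "M > 0" "\<alpha> \<in> A" "\<forall>k<s. M * (n * x k) = \<alpha> k"
      using n(2) unfolding S_def by blast
    have "\<forall>k<s. (M * \<bar>n\<bar>) * x k = sgn n * \<alpha> k"
    proof (intro allI impI)
      fix k assume "k < s"
      then have "\<alpha> k = M * (n * x k)" using M(3) by auto
      then show "(M * \<bar>n\<bar>) * x k = sgn n * \<alpha> k" by (simp add: abs_sgn algebra_simps)
    qed
    then show ?thesis
      unfolding S_def using int_subgroup_scale[OF assms M(2), of "sgn n"] M(1) n(1)
      by (auto intro!: exI[of _ "M * \<bar>n\<bar>"])
  qed
  ultimately have S: "saturated S" and S': "int_subgroup S" by (auto simp: saturated_def)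
  have span: "spans_mod S {..<s} unit_vec"
    unfolding spans_mod_def
  proof
    fix x :: "nat \<Rightarrow> int"
    show "\<exists>n. (\<lambda>k. x k - (\<Sum>i<s. n i * unit_vec i k)) \<in> S"
      by (rule exI[of _ x], rule zero) (simp add: unit_vec_def if_distrib cong: if_cong)
  qed
  obtain J z where J: "finite J" "spans_mod S J z"
    and indep: "\<And>n i. (\<lambda>k. \<Sum>i\<in>J. n i * z i k) \<in> S \<Longrightarrow> i \<in> J \<Longrightarrow> n i = 0"
    using saturated_complement_basis[OF S finite_lessThan span] by auto
  have "\<forall>k. \<exists>m. (\<lambda>l. unit_vec k l - (\<Sum>i\<in>J. m i * z i l)) \<in> S"
    using J(2) unfolding spans_mod_def by auto
  from choice[OF this] obtain n
    where n: "\<And>k. (\<lambda>l. unit_vec k l - (\<Sum>i\<in>J. n k i * z i l)) \<in> S"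
    by auto
  \<comment> \<open>Coordinates with respect to the basis \<open>z\<close> of the quotient. Building
    them from the expansions of the unit vectors makes them linear in \<open>x\<close> by
    definition.\<close>
  define coord where "coord = (\<lambda>x i. \<Sum>k<s. x k * n k i)"
  have coord: "(\<lambda>l. x l - (\<Sum>i\<in>J. coord x i * z i l)) \<in> S" for x
  proof -
    have 1: "(\<lambda>l. \<Sum>k<s. x k * (unit_vec k l - (\<Sum>i\<in>J. n k i * z i l))) \<in> S"
      by (rule int_subgroup_sum[OF S']) (auto intro: n)
    have 2: "(\<Sum>k<s. x k * (unit_vec k l - (\<Sum>i\<in>J. n k i * z i l))) =
        (\<Sum>k<s. x k * unit_vec k l) - (\<Sum>i\<in>J. coord x i * z i l)" for l
      unfolding coord_def sum_distrib_right sum_distrib_left right_diff_distrib sum_subtractf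
      by (subst sum.swap) (simp add: mult.assoc)
    have 3: "(\<lambda>l. x l - (\<Sum>k<s. x k * unit_vec k l)) \<in> S"
      by (rule zero) (simp add: unit_vec_def if_distrib cong: if_cong)
    show ?thesis using int_subgroup_add[OF S' 3 1] by (simp add: 2)
  qed
  have coord_A: "coord x i = 0" if "x \<in> A" "i \<in> J" for x i
  proof -
    have "x \<in> S" using that(1) unfolding S_def by (auto intro!: exI[of _ 1])
    then have "(\<lambda>l. x l - (x l - (\<Sum>i\<in>J. coord x i * z i l))) \<in> S"
      using int_subgroup_diff[OF S' _ coord] by blast
    then show ?thesis using indep[of "coord x" i] that(2) by simp
  qed
  obtain g u where gu: "(\<Sum>i\<in>J. coord v i * u i) = g" "\<And>i. i \<in> J \<Longrightarrow> g dvd coord v i"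
    using int_bezout_family[OF J(1), of "coord v"] by auto
  \<comment> \<open>The extra factor \<open>g\<close> makes the value at \<open>v\<close> equal to
    \<open>g * g\<close>, which is 1 for either unit.\<close>
  define l where "l = (\<lambda>k. g * (\<Sum>i\<in>J. n k i * u i))"
  have l: "(\<Sum>k<s. l k * x k) = g * (\<Sum>i\<in>J. coord x i * u i)" for x
    unfolding l_def coord_def sum_distrib_right sum_distrib_left
    by (subst sum.swap) (simp add: mult_ac)
  show ?thesis
  proof (cases "\<bar>g\<bar> = 1")
    case True
    then have "g * g = 1" by (metis abs_mult_self_eq mult_1)
    then show ?thesis
      using functional[of l] l gu(1) coord_A by simp
  next
    case False
    \<comment> \<open>If \<open>g = 0\<close>, all coordinates of \<open>v\<close> vanish and any
      \<open>p\<close> divides them; 2 is an arbitrary choice.\<close>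
    define p where "p = (if g = 0 then 2 else \<bar>g\<bar>)"
    have p: "p > 1" "\<And>i. i \<in> J \<Longrightarrow> p dvd coord v i"
      using False gu(2) by (auto simp: p_def)
    obtain q where q: "\<And>i. i \<in> J \<Longrightarrow> coord v i = p * q i"
      using p(2) unfolding dvd_def by metis
    obtain N \<alpha> where N: "N > 0" "\<alpha> \<in> A"
      "\<And>k. k < s \<Longrightarrow> N * (v k - (\<Sum>i\<in>J. coord v i * z i k)) = \<alpha> k"
      using coord[of v] unfolding S_def by blast
    have "N * p dvd N * v k - \<alpha> k" if "k < s" for k
    proof -
      have "(\<Sum>i\<in>J. coord v i * z i k) = p * (\<Sum>i\<in>J. q i * z i k)"
        by (simp add: q sum_distrib_left mult.assoc)
      then have "N * v k - \<alpha> k = N * p * (\<Sum>i\<in>J. q i * z i k)"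
        using N(3)[OF that] by (simp add: algebra_simps)
      then show ?thesis by simp
    qed
    then show ?thesis using obstruction[OF N(1) p(1) N(2)] by blast
  qed
qed

section \<open>Relators of a finitely generated group\<close>

text \<open>Indexing sign characters by the generators sent to -1 leaves only finitely many to
  treat, namely the subsets of \<open>{..<s}\<close>.\<close>

definition subset_sign :: "nat set \<Rightarrow> nat \<Rightarrow> int" where
  "subset_sign T i = (if i \<in> T then -1 else 1)"

lemma subset_sign_cases: "subset_sign T i \<in> {1, -1}"
  by (simp add: subset_sign_def)

lemma subset_sign_empty [simp]: "subset_sign {} = (\<lambda>_. 1)"
  by (simp add: subset_sign_def fun_eq_iff)

lemmas word_cross_inv_subset_sign [simp] =
  word_cross_inv[of "subset_sign T" for T, OF subset_sign_cases]

text \<open>Orthogonality of the characters of an elementary abelian 2-group, in product form: one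
  generator on which they disagree contributes a zero factor.\<close>

lemma prod_subset_sign:
  assumes "T \<subseteq> {..<s}" "T' \<subseteq> {..<s}"
  shows "(\<Prod>i<s. 1 + subset_sign T i * subset_sign T' i) = (if T = T' then 2 ^ s else 0)"
proof (cases "T = T'")
  case True
  have "1 + subset_sign T i * subset_sign T i = 2" for i
    by (simp add: subset_sign_def)
  then show ?thesis using True by simp
next
  case False
  then obtain i where "i < s" "i \<in> T \<longleftrightarrow> i \<notin> T'" using assms by blast
  then have "\<exists>i\<in>{..<s}. 1 + subset_sign T i * subset_sign T' i = 0"
    by (intro bexI[of _ i]) (auto simp: subset_sign_def)
  then show ?thesis using False by (simp add: prod_zero)
qed

locale generated_group = group G for G (structure) +
  fixes x :: "nat \<Rightarrow> 'a" and s :: nat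
  assumes gen_closed: "\<And>i. i < s \<Longrightarrow> x i \<in> carrier G"
    and gen_surj: "\<And>g. g \<in> carrier G \<Longrightarrow> \<exists>w\<in>words s. word_eval G x w = g"
begin

definition relators :: "word set" where
  "relators = {w \<in> words s. word_eval G x w = \<one>}"

text \<open>On these relators the crossed homomorphisms for all signs are additive at once, so
  relators built for different signs can be concatenated without interference.\<close>

definition even_relators :: "word set" where
  "even_relators = {w \<in> relators. \<forall>T. word_sign (subset_sign T) w = 1}"

lemma relators_words: "w \<in> relators \<Longrightarrow> w \<in> words s"
  by (simp add: relators_def)

lemma eval_closed [simp]: "w \<in> words s \<Longrightarrow> word_eval G x w \<in> carrier G"
  by (rule word_eval_closed[OF _ gen_closed])

lemma eval_append [simp]:
  "u \<in> words s \<Longrightarrow> v \<in> words s \<Longrightarrow> word_eval G x (u @ v) = word_eval G x u \<otimes> word_eval G x v"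
  by (rule word_eval_append[OF _ _ gen_closed])

lemma eval_inv [simp]: "w \<in> words s \<Longrightarrow> word_eval G x (word_inv w) = inv (word_eval G x w)"
  by (rule word_eval_inv[OF _ gen_closed])

lemma Nil_relator: "[] \<in> relators"
  by (simp add: relators_def)

lemma append_relator: "u \<in> relators \<Longrightarrow> v \<in> relators \<Longrightarrow> u @ v \<in> relators"
  by (simp add: relators_def)

lemma inv_relator: "w \<in> relators \<Longrightarrow> word_inv w \<in> relators"
  by (simp add: relators_def)

lemma conj_relator:
  assumes "w \<in> relators" "i < s"
  shows "(i, True) # w @ [(i, False)] \<in> relators"
  using assms gen_closed[of i] by (auto simp: relators_def word_eval_append[OF _ _ gen_closed])

lemma relator_of_eval_eq:
  assumes "u \<in> words s" "v \<in> words s" "word_eval G x u = word_eval G x v"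
  shows "u @ word_inv v \<in> relators"
  using assms by (simp add: relators_def)

lemma even_relator_multiple:
  assumes "r \<in> even_relators"
  shows "\<exists>r'\<in>even_relators. \<forall>T c.
    word_cross (subset_sign T) c r' = int n * word_cross (subset_sign T) c r"
proof (induction n)
  case 0
  show ?case by (rule bexI[of _ "[]"]) (auto simp: even_relators_def Nil_relator)
next
  case (Suc n)
  then obtain r' where r': "r' \<in> even_relators"
    "\<And>T c. word_cross (subset_sign T) c r' = int n * word_cross (subset_sign T) c r" by blast
  then show ?case
    using assms by (intro bexI[of _ "r @ r'"]) (auto simp: even_relators_def append_relator algebra_simps)
qed

text \<open>Averaging the conjugates of a relator against the character with sign set \<open>T\<close> isolates the
  corresponding isotypic component.\<close>

lemma even_relator_projection:
  assumes "r \<in> even_relators" "n \<le> s"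
  shows "\<exists>r'\<in>even_relators. \<forall>T' c. word_cross (subset_sign T') c r' =
    (\<Prod>i<n. 1 + subset_sign T i * subset_sign T' i) * word_cross (subset_sign T') c r"
  using assms(2)
proof (induction n)
  case 0
  then show ?case using assms(1) by (intro bexI[of _ r]) auto
next
  case (Suc n)
  then obtain r' where r': "r' \<in> even_relators"
    "\<And>T' c. word_cross (subset_sign T') c r' =
      (\<Prod>i<n. 1 + subset_sign T i * subset_sign T' i) * word_cross (subset_sign T') c r"
    by auto
  have [simp]: "word_sign (subset_sign T') r' = 1" and rel: "r' \<in> relators" for T'
    using r'(1) by (auto simp: even_relators_def)
  \<comment> \<open>Conjugation by the generator \<open>n\<close> multiplies the crossed value by
    the sign of that generator; appending \<open>v\<close> or its inverse, according to
    \<open>T\<close>, then produces the next factor of the product.\<close>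
  define v where "v = (n, True) # r' @ [(n, False)]"
  define u where "u = r' @ (if n \<in> T then word_inv v else v)"
  have v: "v \<in> relators" "word_sign (subset_sign T') v = 1"
    "word_cross (subset_sign T') c v = subset_sign T' n * word_cross (subset_sign T') c r'" for T' c
    using conj_relator[OF rel, of n] Suc.prems by (auto simp: v_def subset_sign_def)
  have "u \<in> even_relators"
    using v(1,2) rel by (auto simp: u_def even_relators_def append_relator inv_relator)
  moreover have "word_cross (subset_sign T') c u =
      (1 + subset_sign T n * subset_sign T' n) * word_cross (subset_sign T') c r'" for T' c
    using v(2,3) by (auto simp: u_def subset_sign_def[of T] algebra_simps)
  ultimately show ?case
    by (intro bexI[of _ u]) (auto simp: r'(2) mult_ac)
qed

text \<open>Each \<open>\<rho> T\<close> is projected to its own character and the results are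
  concatenated. The factor \<open>2 ^ s\<close> is the price of averaging without division.\<close>

lemma even_relator_combination:
  assumes "finite F" "F \<subseteq> Pow {..<s}" "\<And>T. T \<in> F \<Longrightarrow> \<rho> T \<in> even_relators"
  shows "\<exists>r\<in>even_relators. \<forall>T c. T \<subseteq> {..<s} \<longrightarrow> word_cross (subset_sign T) c r =
    (if T \<in> F then 2 ^ s * word_cross (subset_sign T) c (\<rho> T) else 0)"
  using assms
proof (induction F rule: finite_induct)
  case empty
  show ?case by (rule bexI[of _ "[]"]) (auto simp: even_relators_def Nil_relator)
next
  case (insert T F)
  then obtain r where r: "r \<in> even_relators"
    "\<And>T c. T \<subseteq> {..<s} \<Longrightarrow> word_cross (subset_sign T) c r =
      (if T \<in> F then 2 ^ s * word_cross (subset_sign T) c (\<rho> T) else 0)"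
    by auto
  obtain r' where r': "r' \<in> even_relators"
    "\<And>T' c. word_cross (subset_sign T') c r' =
      (\<Prod>i<s. 1 + subset_sign T i * subset_sign T' i) * word_cross (subset_sign T') c (\<rho> T)"
    using even_relator_projection[of "\<rho> T" s T] insert.prems by auto
  have mem: "r @ r' \<in> even_relators"
    using r(1) r'(1) by (auto simp: even_relators_def append_relator)
  have eq: "word_cross (subset_sign T') c (r @ r') =
      (if T' \<in> insert T F then 2 ^ s * word_cross (subset_sign T') c (\<rho> T') else 0)"
    if "T' \<subseteq> {..<s}" for T' c
    using r(1) r(2)[OF that] r'(2) insert.prems(1) insert.hyps(2) that
    by (auto simp: even_relators_def prod_subset_sign)
  show ?case by (intro bexI[OF _ mem] allI impI) (rule eq)
qed

text \<open>The lattice alternative is applied to the vectors of Fox derivatives of the relators: a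
  functional vanishing on them is a crossed homomorphism that kills the relators. Trivial signs on
  relators make these vectors a subgroup.\<close>

lemma cocycle_or_obstruction:
  assumes signs: "\<And>r. r \<in> relators \<Longrightarrow> word_sign (subset_sign T) r = 1" and "j < s"
  shows "(\<exists>c. (\<forall>r\<in>relators. word_cross (subset_sign T) c r = 0) \<and> c j = 1) \<or>
    (\<exists>N p r. N > 0 \<and> p > 1 \<and> r \<in> relators \<and>
      (\<forall>i<s. N * p dvd N * unit_vec j i - word_cross (subset_sign T) (unit_vec i) r))"
proof -
  define D where "D = (\<lambda>r i. word_cross (subset_sign T) (unit_vec i) r)"
  have D: "int_subgroup (D ` relators)"
    unfolding int_subgroup_def
  proof (intro conjI ballI)
    show "(\<lambda>_. 0) \<in> D ` relators"
      by (rule image_eqI[OF _ Nil_relator]) (simp add: D_def)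
  next
    fix y z assume "y \<in> D ` relators" "z \<in> D ` relators"
    then obtain u v where uv: "u \<in> relators" "v \<in> relators" "y = D u" "z = D v" by blast
    have "(\<lambda>k. y k - z k) = D (u @ word_inv v)"
      using uv signs by (simp add: D_def)
    then show "(\<lambda>k. y k - z k) \<in> D ` relators"
      by (rule image_eqI) (intro append_relator inv_relator uv)
  qed
  show ?thesis
  proof (rule integer_functional_or_obstruction[OF D, where s = s and v = "unit_vec j"])
    fix l assume l: "\<And>y. y \<in> D ` relators \<Longrightarrow> (\<Sum>k<s. l k * y k) = 0"
      "(\<Sum>k<s. l k * unit_vec j k) = 1"
    have "word_cross (subset_sign T) l r = 0" if "r \<in> relators" for r
      using l(1)[OF imageI[OF that]] word_cross_linear[OF relators_words[OF that], of _ l]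
      by (simp add: D_def)
    moreover have "l j = 1"
      using l(2) \<open>j < s\<close> by (simp add: unit_vec_def if_distrib cong: if_cong)
    ultimately show ?thesis by auto
  next
    fix N p y assume Np: "N > 0" "p > 1" and "y \<in> D ` relators"
      and y: "\<And>k. k < s \<Longrightarrow> N * p dvd N * unit_vec j k - y k"
    then obtain r where r: "r \<in> relators" "y = D r" by blast
    have "\<forall>i<s. N * p dvd N * unit_vec j i - word_cross (subset_sign T) (unit_vec i) r"
      using y by (simp add: r(2) D_def)
    then show ?thesis using Np r(1) by auto
  qed
qed

text \<open>Words with the same value in \<open>G\<close> differ by a relator, so the sign and the
  crossed homomorphism do not depend on the word chosen.\<close>

lemma cocycle_descends:
  assumes \<epsilon>: "\<And>i. \<epsilon> i \<in> {1, -1}"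
    and "\<And>r. r \<in> relators \<Longrightarrow> word_sign \<epsilon> r = 1"
    and "\<And>r. r \<in> relators \<Longrightarrow> word_cross \<epsilon> c r = 0"
  shows "\<exists>\<sigma> \<kappa>. (\<forall>w\<in>words s. \<sigma> (word_eval G x w) = word_sign \<epsilon> w) \<and>
    (\<forall>w\<in>words s. \<kappa> (word_eval G x w) = word_cross \<epsilon> c w) \<and>
    (\<forall>g\<in>carrier G. \<forall>h\<in>carrier G. \<sigma> (g \<otimes> h) = \<sigma> g * \<sigma> h) \<and>
    (\<forall>g\<in>carrier G. \<forall>h\<in>carrier G. \<kappa> (g \<otimes> h) = \<kappa> g + \<sigma> g * \<kappa> h) \<and>
    (\<forall>g\<in>carrier G. \<sigma> g \<in> {1, -1})"
proof -
  have eq: "word_sign \<epsilon> u = word_sign \<epsilon> v \<and> word_cross \<epsilon> c u = word_cross \<epsilon> c v"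
    if "u \<in> words s" "v \<in> words s" "word_eval G x u = word_eval G x v" for u v
  proof -
    have rel: "u @ word_inv v \<in> relators" by (rule relator_of_eval_eq[OF that])
    have "word_sign \<epsilon> u * word_sign \<epsilon> v = 1" using assms(2)[OF rel] by simp
    then have sgn: "word_sign \<epsilon> u = word_sign \<epsilon> v"
      using word_sign_cases[of \<epsilon> u] word_sign_cases[of \<epsilon> v] \<epsilon> by auto
    have "word_cross \<epsilon> c u = word_sign \<epsilon> v * word_sign \<epsilon> v * word_cross \<epsilon> c v"
      using assms(3)[OF rel] word_cross_inv[of \<epsilon> c v] \<epsilon> by (simp add: sgn mult.assoc)
    then show ?thesis using sgn word_sign_square[of \<epsilon> v] \<epsilon> by simp
  qed
  define wd where "wd = (\<lambda>g. SOME w. w \<in> words s \<and> word_eval G x w = g)"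
  have wd: "wd g \<in> words s" "word_eval G x (wd g) = g" if "g \<in> carrier G" for g
    using someI_ex[of "\<lambda>w. w \<in> words s \<and> word_eval G x w = g"] gen_surj[OF that]
    by (auto simp: wd_def)
  define \<sigma> where "\<sigma> = (\<lambda>g. word_sign \<epsilon> (wd g))"
  define \<kappa> where "\<kappa> = (\<lambda>g. word_cross \<epsilon> c (wd g))"
  have ev: "\<sigma> (word_eval G x w) = word_sign \<epsilon> w" "\<kappa> (word_eval G x w) = word_cross \<epsilon> c w"
    if "w \<in> words s" for w
    using eq[OF wd(1) that wd(2)] that by (auto simp: \<sigma>_def \<kappa>_def)
  have mult: "\<sigma> (g \<otimes> h) = \<sigma> g * \<sigma> h" "\<kappa> (g \<otimes> h) = \<kappa> g + \<sigma> g * \<kappa> h"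
    if "g \<in> carrier G" "h \<in> carrier G" for g h
    using ev[of "wd g @ wd h"] wd[OF that(1)] wd[OF that(2)] by (auto simp: \<sigma>_def \<kappa>_def)
  have pm: "\<sigma> g \<in> {1, -1}" for g
    unfolding \<sigma>_def by (rule word_sign_cases[OF \<epsilon>])
  show ?thesis
    by (intro exI[of _ \<sigma>] exI[of _ \<kappa>] conjI ballI ev mult pm)
qed

end

section \<open>Verbally closed Klein bottle groups\<close>

lemma klein_endomorphism_identity:
  assumes hom: "\<And>y z. \<psi> (y \<otimes>\<^bsub>klein_group\<^esub> z) = \<psi> y \<otimes>\<^bsub>klein_group\<^esub> \<psi> z"
    and gens: "\<psi> (1, 0) = (1, 0)" "\<psi> (0, 1) = (0, 1)"
  shows "\<psi> y = y"
proof -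
  have shift: "\<psi> (m + 1, 0) = (fst (\<psi> (m, 0)) + parity_sign (snd (\<psi> (m, 0))), snd (\<psi> (m, 0)))"
    "\<psi> (0, m + 1) = (fst (\<psi> (0, m)), snd (\<psi> (0, m)) + 1)" for m
    using hom[of "(m, 0)" "(1, 0)"] hom[of "(0, m)" "(0, 1)"] gens
    by (cases "\<psi> (m, 0)"; cases "\<psi> (0, m)"; simp add: klein_mult parity_sign_def)+
  have zero: "\<psi> (0, 0) = (0, 0)"
    using shift(2)[of 0] gens(2) by (simp add: prod_eq_iff)
  have 1: "\<psi> (m, 0) = (m, 0)" for m
  proof (induction m rule: int_induct[where k = 0])
    case (step2 i)
    then show ?case using shift(1)[of "i - 1"] by (auto simp: prod_eq_iff parity_sign_def)
  qed (auto simp: zero shift parity_sign_def)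
  have 2: "\<psi> (0, n) = (0, n)" for n
  proof (induction n rule: int_induct[where k = 0])
    case (step2 i)
    then show ?case using shift(2)[of "i - 1"] by (simp add: prod_eq_iff)
  qed (auto simp: zero shift)
  show ?thesis
    using hom[of "(fst y, 0)" "(0, snd y)"] by (simp add: 1 2 klein_mult)
qed

text \<open>Having the images of \<open>a\<close> and \<open>b\<close> as the first two generators
  lets their powers be written as words.\<close>

locale klein_verbally_closed = generated_group +
  fixes \<phi> :: "int \<times> int \<Rightarrow> 'a"
  assumes emb_hom: "\<phi> \<in> hom klein_group G" and emb_inj: "inj \<phi>"
    and emb_closed: "verbally_closed G (range \<phi>)"
    and two_gens: "2 \<le> s" and gen_a: "x 0 = \<phi> (1, 0)" and gen_b: "x 1 = \<phi> (0, 1)"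
begin

lemma emb_mult: "\<phi> (y \<otimes>\<^bsub>klein_group\<^esub> z) = \<phi> y \<otimes> \<phi> z"
  using hom_mult[OF emb_hom] by simp

lemma emb_carrier: "\<phi> y \<in> carrier G"
  using emb_hom by (auto simp: hom_def)

lemma emb_one: "\<phi> (0, 0) = \<one>"
  using hom_one[OF emb_hom klein_group_is_group] is_group by (simp add: klein_one)

text \<open>In \<open>G\<close> the equation is solved by the generators themselves, so verbal
  closedness supplies a solution in the embedded subgroup, which is pulled back along
  \<open>\<phi>\<close>.\<close>

lemma klein_solution:
  assumes "w \<in> words s" "word_eval G x w = \<phi> h"
  shows "\<exists>k. word_eval klein_group k w = h"
proof -
  have "\<exists>g. (\<forall>i<s. g i \<in> range \<phi>) \<and> word_eval G g w = \<phi> h"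
    using emb_closed assms gen_closed unfolding verbally_closed_def words_def set_map mem_Collect_eq
    by blast
  then obtain g where g: "\<And>i. i < s \<Longrightarrow> g i \<in> range \<phi>" "word_eval G g w = \<phi> h" by blast
  define k where "k = (\<lambda>i. inv_into UNIV \<phi> (g i))"
  have "word_eval G g w = word_eval G (\<lambda>i. \<phi> (k i)) w"
    by (rule word_eval_cong[OF assms(1)]) (use g(1) in \<open>simp add: k_def f_inv_into_f\<close>)
  also have "\<dots> = \<phi> (word_eval klein_group k w)"
    by (rule word_eval_hom[OF klein_group_is_group is_group emb_hom assms(1)]) simp
  finally show ?thesis using g(2) emb_inj by (auto dest: injD)
qed

lemma eval_gen_powers:
  "word_eval G x (replicate n (0, True)) = \<phi> (int n, 0)"
  "word_eval G x (replicate n (1, True)) = \<phi> (0, int n)"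
proof (induction n)
  case (Suc n)
  show "word_eval G x (replicate (Suc n) (0, True)) = \<phi> (int (Suc n), 0)"
    using Suc(1) emb_mult[of "(1, 0)" "(int n, 0)"]
    by (simp add: gen_a klein_mult parity_sign_def)
  show "word_eval G x (replicate (Suc n) (1, True)) = \<phi> (0, int (Suc n))"
    using Suc(2) emb_mult[of "(0, 1)" "(0, int n)"] gen_b
    by (simp add: klein_mult parity_sign_def)
qed (simp_all add: emb_one)

text \<open>An obstructing relator \<open>r\<close> would give the word \<open>b^N r^-1\<close>,
  with value \<open>b^N\<close> in \<open>G\<close> but all exponent sums divisible by
  \<open>N * p\<close>. A solution in the Klein bottle group would then force \<open>N * p\<close>
  to divide \<open>N\<close>.\<close>

lemma exists_projection_to_int:
  "\<exists>f. (\<forall>r\<in>relators. word_cross (\<lambda>_. 1) f r = 0) \<and> f 1 = 1"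
proof (rule ccontr)
  assume none: "\<nexists>f. (\<forall>r\<in>relators. word_cross (\<lambda>_. 1) f r = 0) \<and> f 1 = 1"
  obtain N p r where Np: "N > 0" "p > 1" and r: "r \<in> relators"
    "\<And>i. i < s \<Longrightarrow> N * p dvd N * unit_vec 1 i - word_cross (\<lambda>_. 1) (unit_vec i) r"
    using cocycle_or_obstruction[of "{}" 1] none two_gens by auto
  define w where "w = replicate (nat N) (1, True) @ word_inv r"
  have w: "w \<in> words s"
    using r(1) two_gens by (auto simp: w_def relators_def)
  have "word_eval G x w = \<phi> (0, N)"
    using r(1) two_gens Np(1) emb_carrier
    by (simp add: w_def relators_def eval_gen_powers del: One_nat_def)
  then obtain k where k: "word_eval klein_group k w = (0, N)"
    using klein_solution[OF w, of "(0, N)"] by auto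
  have "word_cross (\<lambda>_. 1) c (word_inv r) = - word_cross (\<lambda>_. 1) c r" for c
    using word_cross_inv[of "\<lambda>_. 1" c r] by simp
  then have eq: "word_cross (\<lambda>_. 1) c w = N * c 1 - word_cross (\<lambda>_. 1) c r" for c
    using Np(1) by (simp add: w_def word_cross_replicate_one word_sign_replicate_one)
  have "N * p dvd word_cross (\<lambda>_. 1) (\<lambda>i. snd (k i)) w"
    by (rule word_cross_dvd[OF w], unfold eq unit_vec_commute[of _ 1], rule r(2))
  then have "N * p dvd N" using k by (simp add: word_eval_klein)
  then have "p dvd 1" using Np(1) dvd_mult_cancel_left[of N p 1] by simp
  then show False using Np(2) by simp
qed

text \<open>The parities of a solution in the Klein bottle group cannot be prescribed, so a single
  relator must obstruct all signs simultaneously. Signs negative on \<open>a\<close> are excluded by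
  using an even power of \<open>a\<close>.\<close>

lemma exists_projection_to_dihedral:
  "\<exists>T c. 0 \<notin> T \<and> (\<forall>r\<in>relators. word_sign (subset_sign T) r = 1) \<and>
    (\<forall>r\<in>relators. word_cross (subset_sign T) c r = 0) \<and> c 0 = 1"
proof (rule ccontr)
  assume none: "\<nexists>T c. 0 \<notin> T \<and> (\<forall>r\<in>relators. word_sign (subset_sign T) r = 1) \<and>
    (\<forall>r\<in>relators. word_cross (subset_sign T) c r = 0) \<and> c 0 = 1"
  define bad where "bad = (\<lambda>T N p r. N > 0 \<and> p > 1 \<and> r \<in> even_relators \<and>
    (\<forall>i<s. N * p dvd N * unit_vec 0 i - word_cross (subset_sign T) (unit_vec i) r))"
  have "\<exists>N p r. bad T N p r" if T: "0 \<notin> T" for T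
  proof (cases "\<forall>r\<in>relators. word_sign (subset_sign T) r = 1")
    case True
    then have "\<nexists>c. (\<forall>r\<in>relators. word_cross (subset_sign T) c r = 0) \<and> c 0 = 1"
      using none T by blast
    then obtain N p r where *: "N > 0" "p > 1" "r \<in> relators"
      "\<And>i. i < s \<Longrightarrow> N * p dvd N * unit_vec 0 i - word_cross (subset_sign T) (unit_vec i) r"
      using cocycle_or_obstruction[of T 0] True two_gens by auto
    \<comment> \<open>Squaring the relator makes every sign trivial and doubles \<open>N\<close>,
      leaving \<open>p\<close> unchanged.\<close>
    have "word_sign (subset_sign T') r * word_sign (subset_sign T') r = 1" for T'
      by (rule word_sign_square[OF subset_sign_cases])
    then have "r @ r \<in> even_relators"
      using *(3) by (simp add: even_relators_def append_relator)
    moreover have "2 * N * p dvd 2 * N * unit_vec 0 i - word_cross (subset_sign T) (unit_vec i) (r @ r)"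
      if "i < s" for i
      using mult_dvd_mono[OF dvd_refl[of 2] *(4)[OF that]] True *(3) by (simp add: algebra_simps)
    ultimately have "bad T (2 * N) p (r @ r)" using *(1,2) by (simp add: bad_def)
    then show ?thesis by blast
  next
    case False
    then obtain r where r: "r \<in> relators" "word_sign (subset_sign T) r = -1"
      using word_sign_cases[of "subset_sign T"] subset_sign_cases by blast
    \<comment> \<open>If a relator has sign -1, its commutator with \<open>a\<close> is a relator
      with crossed value exactly \<open>2 * c 0\<close>. Hence the required difference is zero for
      \<open>N = 2\<close>, and every \<open>p\<close> divides it.\<close>
    define v where "v = (0, True) # r @ (0, False) # word_inv r"
    have "v \<in> relators"
      using append_relator[OF conj_relator[OF r(1), of 0] inv_relator[OF r(1)]] two_gens
      by (simp add: v_def)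
    moreover have "word_sign (subset_sign T') v = 1" for T'
      using word_sign_square[of "subset_sign T'" r, OF subset_sign_cases]
      by (auto simp: v_def subset_sign_def[of T' 0])
    moreover have "word_cross (subset_sign T) c v = 2 * c 0" for c
      using T r(2) by (simp add: v_def subset_sign_def[of T 0])
    ultimately have "bad T 2 2 v"
      by (auto simp: bad_def even_relators_def unit_vec_def)
    then show ?thesis by blast
  qed
  then obtain N p \<rho> where bad: "\<And>T. 0 \<notin> T \<Longrightarrow> bad T (N T) (p T) (\<rho> T)" by metis
  define F where "F = {T. T \<subseteq> {..<s} \<and> 0 \<notin> T}"
  have F: "finite F" "F \<subseteq> Pow {..<s}" by (auto simp: F_def)
  \<comment> \<open>A common multiple of all \<open>N T\<close>, so that replacing each
    \<open>\<rho> T\<close> by a power makes the obstructions concern the same multiple of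
    \<open>a\<close>.\<close>
  define M where "M = (\<Prod>T\<in>F. N T)"
  have M: "M > 0" unfolding M_def by (rule prod_pos) (use bad in \<open>auto simp: F_def bad_def\<close>)
  have "\<exists>r\<in>even_relators. \<forall>c. word_cross (subset_sign T) c r =
      (M div N T) * word_cross (subset_sign T) c (\<rho> T)" if "T \<in> F" for T
  proof -
    have "\<rho> T \<in> even_relators" "N T > 0" using bad that by (auto simp: F_def bad_def)
    then show ?thesis
      using even_relator_multiple[of "\<rho> T" "nat (M div N T)"] M
      by (auto simp: pos_imp_zdiv_nonneg_iff)
  qed
  then obtain \<rho>' where \<rho>': "\<And>T. T \<in> F \<Longrightarrow> \<rho>' T \<in> even_relators"
    "\<And>T c. T \<in> F \<Longrightarrow> word_cross (subset_sign T) c (\<rho>' T) =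
      (M div N T) * word_cross (subset_sign T) c (\<rho> T)"
    by metis
  obtain r where r: "r \<in> even_relators"
    "\<And>T c. T \<subseteq> {..<s} \<Longrightarrow> word_cross (subset_sign T) c r =
      (if T \<in> F then 2 ^ s * word_cross (subset_sign T) c (\<rho>' T) else 0)"
    using even_relator_combination[of F \<rho>', OF F \<rho>'(1)] by blast
  define m where "m = 2 ^ s * M"
  have m: "m > 0" "even m" using M two_gens by (auto simp: m_def)
  define w where "w = replicate (nat m) (0, True) @ word_inv r"
  have rel: "r \<in> relators" "\<And>T. word_sign (subset_sign T) r = 1"
    using r(1) by (auto simp: even_relators_def)
  have w: "w \<in> words s"
    using rel two_gens by (auto simp: w_def relators_def)
  have "word_eval G x w = \<phi> (m, 0)"
    using rel two_gens m(1) emb_carrier by (simp add: w_def relators_def eval_gen_powers)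
  then obtain k where k: "word_eval klein_group k w = (m, 0)"
    using klein_solution[OF w, of "(m, 0)"] by auto
  \<comment> \<open>The sign character that the solution \<open>k\<close> happens to have.\<close>
  define T where "T = {i. i < s \<and> odd (snd (k i))}"
  have T: "T \<subseteq> {..<s}" by (auto simp: T_def)
  have "word_cross (subset_sign T) (\<lambda>i. fst (k i)) w =
      word_cross (\<lambda>i. parity_sign (snd (k i))) (\<lambda>i. fst (k i)) w"
    by (rule word_cross_cong[OF w]) (auto simp: T_def subset_sign_def parity_sign_def)
  then have val: "word_cross (subset_sign T) (\<lambda>i. fst (k i)) w = m"
    using k by (simp add: word_eval_klein)
  show False
  proof (cases "0 \<in> T")
    case True
    \<comment> \<open>Here \<open>a\<close> has sign -1: its even power contributes nothing, and
      \<open>r\<close> is invisible because \<open>T\<close> lies outside \<open>F\<close>. The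
      value would be 0 instead of \<open>m\<close>.\<close>
    obtain m' where m': "nat m = 2 * m'" using m(2) by (metis evenE even_nat_iff m(1) less_imp_le)
    have "word_cross (subset_sign T) (\<lambda>i. fst (k i)) w = 0"
      using True rel(2) r(2)[OF T] word_cross_replicate_minus_one[of "subset_sign T" 0]
      by (simp add: w_def m' F_def subset_sign_def[of T 0])
    then show False using val m(1) by simp
  next
    case False
    then have TF: "T \<in> F" using T by (auto simp: F_def)
    have b: "N T > 0" "p T > 1"
      "\<And>i. i < s \<Longrightarrow> N T * p T dvd N T * unit_vec 0 i - word_cross (subset_sign T) (unit_vec i) (\<rho> T)"
      using bad[OF False] by (auto simp: bad_def)
    have "N T dvd M" unfolding M_def using F(1) TF by (rule dvd_prodI)
    then obtain q where q: "M = N T * q" by blast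
    \<comment> \<open>With \<open>m = 2 ^ s * q * N T\<close>, every Fox derivative of
      \<open>w\<close> is divisible by \<open>m * p T\<close>, whereas the value is
      \<open>m\<close>.\<close>
    have eq: "word_cross (subset_sign T) c w =
        2 ^ s * q * (N T * c 0 - word_cross (subset_sign T) c (\<rho> T))" for c
      using False m(1) b(1) rel(2) r(2)[OF T] TF \<rho>'(2)[OF TF] q
      by (simp add: w_def subset_sign_def[of T 0] word_cross_replicate_one word_sign_replicate_one
          m_def algebra_simps)
    have "2 ^ s * q * (N T * p T) dvd word_cross (subset_sign T) (\<lambda>i. fst (k i)) w"
      by (rule word_cross_dvd[OF w], unfold eq unit_vec_commute[of _ 0])
        (intro mult_dvd_mono dvd_refl b(3))
    then have "m * p T dvd m * 1" using val by (simp add: m_def q mult_ac)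
    then have "p T dvd 1" using m(1) dvd_mult_cancel_left[of m "p T" 1] by simp
    then show False using b(2) by simp
  qed
qed


text \<open>Where the dihedral sign agrees with the parity of the map to the integers, the two maps
  pair to a homomorphism into the fibre product, which is the Klein bottle group.\<close>

lemma exists_retracting_subgroup:
  "\<exists>L. subgroup L G \<and> range \<phi> \<subseteq> L \<and> finite (rcosets L) \<and> card (rcosets L) \<le> 2 \<and>
    is_retract (G\<lparr>carrier := L\<rparr>) (range \<phi>)"
proof -
  obtain f0 where f0: "\<And>r. r \<in> relators \<Longrightarrow> word_cross (\<lambda>_. 1) f0 r = 0" "f0 1 = 1"
    using exists_projection_to_int by blast
  obtain \<sigma>1 f where \<sigma>1: "\<And>w. w \<in> words s \<Longrightarrow> \<sigma>1 (word_eval G x w) = word_sign (\<lambda>_. 1) w"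
    and f_eval: "\<And>w. w \<in> words s \<Longrightarrow> f (word_eval G x w) = word_cross (\<lambda>_. 1) f0 w"
    and f_mult1: "\<And>g h. g \<in> carrier G \<Longrightarrow> h \<in> carrier G \<Longrightarrow> f (g \<otimes> h) = f g + \<sigma>1 g * f h"
    using cocycle_descends[of "\<lambda>_. 1" f0, OF insertI1 word_sign_one f0(1)] by blast
  have "\<sigma>1 g = 1" if "g \<in> carrier G" for g
    using gen_surj[OF that] \<sigma>1 by auto
  then have f_mult: "f (g \<otimes> h) = f g + f h" if "g \<in> carrier G" "h \<in> carrier G" for g h
    using f_mult1[OF that] that by simp
  obtain T c0 where T: "0 \<notin> T" "\<And>r. r \<in> relators \<Longrightarrow> word_sign (subset_sign T) r = 1"
    "\<And>r. r \<in> relators \<Longrightarrow> word_cross (subset_sign T) c0 r = 0" "c0 0 = 1"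
    using exists_projection_to_dihedral by blast
  obtain \<sigma> \<kappa> where \<sigma>_eval: "\<And>w. w \<in> words s \<Longrightarrow> \<sigma> (word_eval G x w) = word_sign (subset_sign T) w"
    and \<kappa>_eval: "\<And>w. w \<in> words s \<Longrightarrow> \<kappa> (word_eval G x w) = word_cross (subset_sign T) c0 w"
    and \<sigma>_mult: "\<And>g h. g \<in> carrier G \<Longrightarrow> h \<in> carrier G \<Longrightarrow> \<sigma> (g \<otimes> h) = \<sigma> g * \<sigma> h"
    and \<kappa>_mult: "\<And>g h. g \<in> carrier G \<Longrightarrow> h \<in> carrier G \<Longrightarrow> \<kappa> (g \<otimes> h) = \<kappa> g + \<sigma> g * \<kappa> h"
    and \<sigma>_cases: "\<And>g. g \<in> carrier G \<Longrightarrow> \<sigma> g \<in> {1, -1}"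
    using cocycle_descends[of "subset_sign T" c0, OF subset_sign_cases T(2,3)] by blast
  define a where "a = \<phi> (1, 0)"
  define a' where "a' = \<phi> (-1, 0)"
  define b where "b = \<phi> (0, 1)"
  have carr: "a \<in> carrier G" "a' \<in> carrier G" "b \<in> carrier G"
    by (simp_all add: a_def a'_def b_def emb_carrier)
  have rels: "a \<otimes> a' = \<one>" "b \<otimes> a' = a \<otimes> b"
    by (simp_all add: a_def a'_def b_def klein_mult parity_sign_def emb_one flip: emb_mult)
  have "word_eval G x [(0, True)] = a" "word_eval G x [(1, True)] = b"
    using carr two_gens gen_a gen_b by (simp_all add: a_def b_def)
  moreover have "[(0, True)] \<in> words s" "[(1, True)] \<in> words s" using two_gens by simp_all
  ultimately have vals: "\<sigma> a = 1" "\<kappa> a = 1" "f b = 1"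
    using \<sigma>_eval[of "[(0, True)]"] \<kappa>_eval[of "[(0, True)]"] f_eval[of "[(1, True)]"] T(1,4) f0(2)
    by (simp_all add: subset_sign_def)
  have ones: "f \<one> = 0" "\<kappa> \<one> = 0" "\<sigma> \<one> = 1"
    using f_eval[of "[]"] \<kappa>_eval[of "[]"] \<sigma>_eval[of "[]"] by simp_all
  \<comment> \<open>The relation \<open>b a^-1 = a b\<close> gives \<open>f a = - f a\<close>.
    Applied to \<open>\<kappa>\<close> with \<open>\<kappa> a = 1\<close>, it forces
    \<open>b\<close> to have sign -1.\<close>
  have fa: "f a = 0"
    using f_mult[OF carr(1,2)] f_mult[OF carr(3,2)] f_mult[OF carr(1,3)] ones(1) rels by simp
  have \<sigma>b: "\<sigma> b = -1"
    using \<kappa>_mult[OF carr(1,2)] \<kappa>_mult[OF carr(3,2)] \<kappa>_mult[OF carr(1,3)] ones(2) rels vals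
      \<sigma>_cases[OF carr(3)] by auto
  define L where "L = {g \<in> carrier G. \<sigma> g = parity_sign (f g)}"
  have L_mult: "g \<otimes> h \<in> L" if "g \<in> L" "h \<in> L" for g h
    using that by (simp add: L_def f_mult \<sigma>_mult parity_sign_add)
  have inv_vals: "\<sigma> (inv g) = \<sigma> g" "f (inv g) = - f g" if "g \<in> carrier G" for g
  proof -
    have "\<sigma> g * \<sigma> (inv g) = 1" using \<sigma>_mult[of g "inv g"] that ones by simp
    then show "\<sigma> (inv g) = \<sigma> g" using \<sigma>_cases[OF that] by auto
    show "f (inv g) = - f g" using f_mult[of g "inv g"] that ones by simp
  qed
  have L: "subgroup L G"
    by (rule subgroupI) (use L_mult ones inv_vals in \<open>auto simp: L_def parity_sign_def\<close>)
  \<comment> \<open>Outside \<open>L\<close> the two signs are opposite, and two such disagreements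
    cancel in a quotient; this bounds the index by 2.\<close>
  have L_coset: "g \<otimes> inv h \<in> L" if "g \<in> carrier G - L" "h \<in> carrier G - L" for g h
  proof -
    have "\<sigma> g = - parity_sign (f g)" "\<sigma> h = - parity_sign (f h)"
      using that \<sigma>_cases[of g] \<sigma>_cases[of h] by (auto simp: L_def parity_sign_def split: if_splits)
    then show ?thesis
      using that by (auto simp: L_def f_mult \<sigma>_mult inv_vals parity_sign_def)
  qed
  have "\<exists>C. rcosets L \<subseteq> {L, C}"
  proof (cases "carrier G \<subseteq> L")
    case True
    then show ?thesis using coset_join2[OF _ L] by (auto simp: RCOSETS_def)
  next
    case False
    then obtain h where h: "h \<in> carrier G - L" by blast
    have "L #> g \<in> {L, L #> h}" if "g \<in> carrier G" for g
    proof (cases "g \<in> L")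
      case True
      then show ?thesis using coset_join2[OF that L] by simp
    next
      case False
      then have "g \<otimes> inv h \<in> L" using L_coset that h by blast
      then have "g \<in> L #> h"
        using that h by (auto simp: r_coset_def intro!: bexI[of _ "g \<otimes> inv h"] simp: m_assoc)
      then show ?thesis using repr_independence[OF _ _ L, of g h] h by auto
    qed
    then show ?thesis by (auto simp: RCOSETS_def)
  qed
  then obtain C where C: "rcosets L \<subseteq> {L, C}" by blast
  have fin: "finite (rcosets L)" using C by (rule finite_subset) simp
  have two: "card (rcosets L) \<le> 2"
    by (rule order_trans[OF card_mono[OF _ C]]) (simp_all add: card_insert_if)
  \<comment> \<open>The value \<open>\<kappa> b\<close> need not vanish. The subtracted term is
    itself a crossed homomorphism on \<open>L\<close>, half of a principal one, and it normalises
    the image of \<open>b\<close> while leaving that of \<open>a\<close> fixed.\<close>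
  define \<psi> where
    "\<psi> = (\<lambda>g. (\<kappa> g - (if even (f g) then 0 else \<kappa> b), f g))"
  have \<psi>_mult: "\<psi> (g \<otimes> h) = \<psi> g \<otimes>\<^bsub>klein_group\<^esub> \<psi> h" if "g \<in> L" "h \<in> L" for g h
    using that by (auto simp: \<psi>_def L_def klein_mult f_mult \<kappa>_mult parity_sign_def)
  have ab_L: "\<phi> (m, n) \<in> L" for m n
  proof -
    have *: "\<phi> (i, 0) \<in> L" for i
    proof (induction i rule: int_induct[where k = 0])
      case base
      then show ?case using subgroup.one_closed[OF L] by (simp add: emb_one)
    next
      case (step1 i)
      have "a \<in> L" using carr vals fa by (simp add: L_def parity_sign_def)
      then show ?case using L_mult[OF step1(2)] emb_mult[of "(i, 0)" "(1, 0)"]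
        by (simp add: a_def klein_mult parity_sign_def)
    next
      case (step2 i)
      have "a' = inv a" using rels(1) carr by (metis inv_equality inv_inv)
      then have "a' \<in> L" using carr vals fa inv_vals[OF carr(1)] by (simp add: L_def parity_sign_def)
      then show ?case using L_mult[OF step2(2)] emb_mult[of "(i, 0)" "(-1, 0)"]
        by (simp add: a'_def klein_mult parity_sign_def)
    qed
    have b: "b \<in> L" using carr vals \<sigma>b by (simp add: L_def parity_sign_def)
    have "\<phi> (0, i) \<in> L" for i
    proof (induction i rule: int_induct[where k = 0])
      case base
      then show ?case using subgroup.one_closed[OF L] by (simp add: emb_one)
    next
      case (step1 i)
      then show ?case using L_mult[OF step1(2) b] emb_mult[of "(0, i)" "(0, 1)"]
        by (simp add: b_def klein_mult)
    next
      case (step2 i)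
      have "\<phi> (0, -1) \<otimes> b = \<one>"
        using emb_mult[of "(0, -1)" "(0, 1)"] by (simp add: b_def klein_mult emb_one)
      then have "\<phi> (0, -1) = inv b" using carr emb_carrier by (metis inv_equality)
      then have "\<phi> (0, -1) \<in> L" using subgroup.m_inv_closed[OF L b] by simp
      then show ?case using L_mult[OF step2(2)] emb_mult[of "(0, i)" "(0, -1)"]
        by (simp add: klein_mult)
    qed
    from L_mult[OF * this] show ?thesis
      using emb_mult[of "(m, 0)" "(0, n)"] by (simp add: klein_mult)
  qed
  have \<psi>_id: "\<psi> (\<phi> y) = y" for y
  proof -
    have hom: "\<psi> (\<phi> (y \<otimes>\<^bsub>klein_group\<^esub> z)) = \<psi> (\<phi> y) \<otimes>\<^bsub>klein_group\<^esub> \<psi> (\<phi> z)" for y z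
      using ab_L by (cases y; cases z) (auto simp: emb_mult \<psi>_mult)
    have gens: "\<psi> (\<phi> (1, 0)) = (1, 0)" "\<psi> (\<phi> (0, 1)) = (0, 1)"
      using vals fa by (simp_all add: \<psi>_def flip: a_def b_def)
    show ?thesis by (rule klein_endomorphism_identity[OF hom gens])
  qed
  have range_L: "range \<phi> \<subseteq> L" using ab_L by auto
  have "is_retract (G\<lparr>carrier := L\<rparr>) (range \<phi>)"
    unfolding is_retract_def
  proof (intro conjI bexI[of _ "\<lambda>g. \<phi> (\<psi> g)"])
    show "subgroup (range \<phi>) (G\<lparr>carrier := L\<rparr>)"
      by (rule subgroup_incl[OF emb_closed[unfolded verbally_closed_def, THEN conjunct1] L range_L])
    show "\<forall>h\<in>range \<phi>. \<phi> (\<psi> h) = h" using \<psi>_id by auto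
    show "(\<lambda>g. \<phi> (\<psi> g)) \<in> hom (G\<lparr>carrier := L\<rparr>) (G\<lparr>carrier := L, carrier := range \<phi>\<rparr>)"
      by (rule homI) (auto simp: \<psi>_mult emb_mult)
  qed
  then show ?thesis using L range_L fin two by (intro exI[of _ L] conjI)
qed

end

section \<open>A group of which the Klein bottle group is not a retract\<close>

text \<open>\<open>[i, j, k, p, q, r, n]\<close> encodes the affine map of \<open>\<int>\<^sup>3\<close> with translation part \<open>(i, j, k)\<close> and
  linear part \<open>diag(p, q, r)\<close>, together with the integer \<open>n\<close>.\<close>

definition witness_group :: "int list monoid" where
  "witness_group = \<lparr> carrier = {[i, j, k, p, q, r, n] | i j k p q r n.
      p \<in> {1, -1} \<and> q \<in> {1, -1} \<and> r \<in> {1, -1} \<and> p * q * r = parity_sign n},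
    monoid.mult = (\<lambda>u v. [u ! 0 + u ! 3 * v ! 0, u ! 1 + u ! 4 * v ! 1, u ! 2 + u ! 5 * v ! 2,
      u ! 3 * v ! 3, u ! 4 * v ! 4, u ! 5 * v ! 5, u ! 6 + v ! 6]),
    one = [0, 0, 0, 1, 1, 1, 0] \<rparr>"

text \<open>A diagonal embedding; the sign condition holds because the cube of a sign is that
  sign.\<close>

definition witness_embedding :: "int \<times> int \<Rightarrow> int list" where
  "witness_embedding = (\<lambda>(m, n). [m, m, m, parity_sign n, parity_sign n, parity_sign n, n])"

lemma parity_sign_minus [simp]: "parity_sign (- n) = parity_sign n"
  by (simp add: parity_sign_def)

lemma witness_carrier:
  "[i, j, k, p, q, r, n] \<in> carrier witness_group \<longleftrightarrow>
    p \<in> {1, -1} \<and> q \<in> {1, -1} \<and> r \<in> {1, -1} \<and> p * q * r = parity_sign n"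
  by (auto simp: witness_group_def)

lemma witness_carrierE:
  assumes "u \<in> carrier witness_group"
  obtains i j k p q r n where "u = [i, j, k, p, q, r, n]"
    "p \<in> {1, -1}" "q \<in> {1, -1}" "r \<in> {1, -1}" "p * q * r = parity_sign n"
  using assms unfolding witness_group_def by auto

lemma witness_mult:
  "[i, j, k, p, q, r, n] \<otimes>\<^bsub>witness_group\<^esub> [i', j', k', p', q', r', n'] =
    [i + p * i', j + q * j', k + r * k', p * p', q * q', r * r', n + n']"
  by (simp add: witness_group_def numeral_eq_Suc)

lemma witness_one: "\<one>\<^bsub>witness_group\<^esub> = [0, 0, 0, 1, 1, 1, 0]"
  by (simp add: witness_group_def)

lemma witness_is_group: "group witness_group"
proof (rule groupI)
  fix u v w
  assume u: "u \<in> carrier witness_group" and v: "v \<in> carrier witness_group"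
    and w: "w \<in> carrier witness_group"
  show "u \<otimes>\<^bsub>witness_group\<^esub> v \<in> carrier witness_group"
  proof -
    obtain i j k p q r n where u': "u = [i, j, k, p, q, r, n]"
      "p \<in> {1, -1}" "q \<in> {1, -1}" "r \<in> {1, -1}" "p * q * r = parity_sign n"
      using u by (rule witness_carrierE)
    obtain i' j' k' p' q' r' n' where v': "v = [i', j', k', p', q', r', n']"
      "p' \<in> {1, -1}" "q' \<in> {1, -1}" "r' \<in> {1, -1}" "p' * q' * r' = parity_sign n'"
      using v by (rule witness_carrierE)
    have "p * p' * (q * q') * (r * r') = parity_sign (n + n')"
      by (simp add: parity_sign_add mult_ac flip: u'(5) v'(5))
    then show ?thesis
      using u'(2-4) v'(2-4) unfolding u'(1) v'(1) witness_mult witness_carrier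
      by (intro conjI) (auto simp del: mult_eq_1_iff)
  qed
  show "u \<otimes>\<^bsub>witness_group\<^esub> v \<otimes>\<^bsub>witness_group\<^esub> w =
      u \<otimes>\<^bsub>witness_group\<^esub> (v \<otimes>\<^bsub>witness_group\<^esub> w)"
    using u v w by (elim witness_carrierE) (simp add: witness_mult algebra_simps)
next
  fix u assume u: "u \<in> carrier witness_group"
  show "\<one>\<^bsub>witness_group\<^esub> \<otimes>\<^bsub>witness_group\<^esub> u = u"
    using u by (elim witness_carrierE) (simp add: witness_mult witness_one)
  obtain i j k p q r n where e: "u = [i, j, k, p, q, r, n]"
    "p \<in> {1, -1}" "q \<in> {1, -1}" "r \<in> {1, -1}" "p * q * r = parity_sign n"
    using u by (rule witness_carrierE)
  have "p * p = 1" "q * q = 1" "r * r = 1" using e(2-4) by auto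
  then show "\<exists>v\<in>carrier witness_group. v \<otimes>\<^bsub>witness_group\<^esub> u = \<one>\<^bsub>witness_group\<^esub>"
    by (intro bexI[of _ "[- p * i, - q * j, - r * k, p, q, r, - n]"])
      (use e in \<open>simp_all add: witness_mult witness_one witness_carrier\<close>)
qed (simp add: witness_one witness_carrier parity_sign_def)

lemma witness_inv:
  assumes "[i, j, k, p, q, r, n] \<in> carrier witness_group"
  shows "inv\<^bsub>witness_group\<^esub> [i, j, k, p, q, r, n] = [- p * i, - q * j, - r * k, p, q, r, - n]"
proof (rule group.inv_equality[OF witness_is_group])
  have "p \<in> {1, -1}" "q \<in> {1, -1}" "r \<in> {1, -1}"
    using assms unfolding witness_carrier by blast+
  then have "p * p = 1" "q * q = 1" "r * r = 1" by auto
  then show "[- p * i, - q * j, - r * k, p, q, r, - n] \<otimes>\<^bsub>witness_group\<^esub> [i, j, k, p, q, r, n] =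
      \<one>\<^bsub>witness_group\<^esub>"
    by (simp add: witness_mult witness_one)
qed (use assms in \<open>simp_all add: witness_carrier\<close>)

lemma witness_embedding_hom: "witness_embedding \<in> hom klein_group witness_group"
proof (rule homI)
  fix y z :: "int \<times> int"
  obtain m n m' n' where yz: "y = (m, n)" "z = (m', n')" by fastforce
  show "witness_embedding y \<in> carrier witness_group"
    by (simp add: yz witness_embedding_def witness_carrier parity_sign_def)
  show "witness_embedding (y \<otimes>\<^bsub>klein_group\<^esub> z) =
      witness_embedding y \<otimes>\<^bsub>witness_group\<^esub> witness_embedding z"
    by (simp add: yz witness_embedding_def klein_mult witness_mult parity_sign_add)
qed

lemma witness_embedding_inj: "inj witness_embedding"
  by (auto simp: inj_def witness_embedding_def)

lemma witness_finitely_generated: "finitely_generated witness_group"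
proof -
  interpret group witness_group by (rule witness_is_group)
  \<comment> \<open>Three unit translations, the image of \<open>b\<close>, and the four sign
    triples of product 1.\<close>
  define S :: "int list set" where "S = {[1, 0, 0, 1, 1, 1, 0], [0, 1, 0, 1, 1, 1, 0],
    [0, 0, 1, 1, 1, 1, 0], [0, 0, 0, -1, -1, -1, 1], [0, 0, 0, 1, 1, 1, 0],
    [0, 0, 0, -1, -1, 1, 0], [0, 0, 0, -1, 1, -1, 0], [0, 0, 0, 1, -1, -1, 0]}"
  have S: "S \<subseteq> carrier witness_group"
    by (simp add: S_def witness_carrier parity_sign_def)
  have sub: "subgroup (generate witness_group S) witness_group"
    by (rule generate_is_subgroup[OF S])
  have mult: "u \<otimes>\<^bsub>witness_group\<^esub> v \<in> generate witness_group S"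
    if "u \<in> generate witness_group S" "v \<in> generate witness_group S" for u v
    using that by (rule generate.eng)
  have one: "[0, 0, 0, 1, 1, 1, 0] \<in> generate witness_group S"
    using generate.one[of witness_group S] by (simp add: witness_one)
  \<comment> \<open>\<open>F\<close> is a closed form for the integer powers of one generator, so
    each family below needs only the two step identities.\<close>
  have powers: "F n \<in> generate witness_group S"
    if F: "F 0 = [0, 0, 0, 1, 1, 1, 0]" "F 1 \<in> S"
      "\<And>m. F (m + 1) = F m \<otimes>\<^bsub>witness_group\<^esub> F 1"
      "\<And>m. F (m - 1) = F m \<otimes>\<^bsub>witness_group\<^esub> inv\<^bsub>witness_group\<^esub> F 1" for F and n :: int
  proof (induction n rule: int_induct[where k = 0])
    case base
    show ?case using F(1) one by simp
  next
    case (step1 i)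
    then show ?case using F(2,3) mult generate.incl by metis
  next
    case (step2 i)
    then show ?case using F(2,4) mult generate.inv by metis
  qed
  have t1: "[i, 0, 0, 1, 1, 1, 0] \<in> generate witness_group S" for i
    by (rule powers[of "\<lambda>i. [i, 0, 0, 1, 1, 1, 0]"])
      (auto simp: S_def witness_mult witness_inv witness_carrier parity_sign_def)
  have t2: "[0, j, 0, 1, 1, 1, 0] \<in> generate witness_group S" for j
    by (rule powers[of "\<lambda>j. [0, j, 0, 1, 1, 1, 0]"])
      (auto simp: S_def witness_mult witness_inv witness_carrier parity_sign_def)
  have t3: "[0, 0, k, 1, 1, 1, 0] \<in> generate witness_group S" for k
    by (rule powers[of "\<lambda>k. [0, 0, k, 1, 1, 1, 0]"])
      (auto simp: S_def witness_mult witness_inv witness_carrier parity_sign_def)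
  have b: "[0, 0, 0, parity_sign n, parity_sign n, parity_sign n, n] \<in> generate witness_group S" for n
    by (rule powers[of "\<lambda>n. [0, 0, 0, parity_sign n, parity_sign n, parity_sign n, n]"])
      (auto simp: S_def witness_mult witness_inv witness_carrier parity_sign_def)
  have "u \<in> generate witness_group S" if "u \<in> carrier witness_group" for u
  proof -
    obtain i j k p q r n where u: "u = [i, j, k, p, q, r, n]"
      "p \<in> {1, -1}" "q \<in> {1, -1}" "r \<in> {1, -1}" "p * q * r = parity_sign n"
      using \<open>u \<in> carrier witness_group\<close> by (rule witness_carrierE)
    define e where "e = parity_sign n"
    \<comment> \<open>Splitting off the signs of \<open>b^n\<close> leaves a triple of product 1, so
      \<open>u\<close> factors as translations, such a triple, and \<open>b^n\<close>.\<close>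
    have "[0, 0, 0, e * p, e * q, e * r, 0] \<in> S"
      using u(2-5) unfolding S_def e_def[symmetric] by auto
    then have "[0, 0, 0, e * p, e * q, e * r, 0] \<in> generate witness_group S"
      by (rule generate.incl)
    from mult[OF t1 mult[OF t2 mult[OF t3 mult[OF this b]]], of i j k n] show ?thesis
      using u by (auto simp: witness_mult e_def parity_sign_def split: if_splits)
  qed
  then have "generate witness_group S = carrier witness_group"
    using subgroup.subset[OF sub] by blast
  moreover have "finite S" by (simp add: S_def)
  ultimately show ?thesis unfolding finitely_generated_def using S by blast
qed

lemma word_eval_witness:
  assumes "w \<in> words s" "\<And>l. l < s \<Longrightarrow> g l \<in> carrier witness_group"
  shows "word_eval witness_group g w =
    [word_cross (\<lambda>l. g l ! 3) (\<lambda>l. g l ! 0) w, word_cross (\<lambda>l. g l ! 4) (\<lambda>l. g l ! 1) w,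
     word_cross (\<lambda>l. g l ! 5) (\<lambda>l. g l ! 2) w, word_sign (\<lambda>l. g l ! 3) w,
     word_sign (\<lambda>l. g l ! 4) w, word_sign (\<lambda>l. g l ! 5) w, word_cross (\<lambda>_. 1) (\<lambda>l. g l ! 6) w]"
  using assms(1)
proof (induction rule: words_induct)
  case (Cons l e w)
  obtain i j k p q r n where u: "g l = [i, j, k, p, q, r, n]"
    using assms(2)[OF Cons.hyps(1)] by (rule witness_carrierE)
  show ?case
    using Cons.IH witness_inv[of i j k p q r n] assms(2)[OF Cons.hyps(1)]
    by (simp add: u witness_mult numeral_eq_Suc)
qed (simp add: witness_one)

text \<open>Changing \<open>f'\<close> within its parity class shifts the sum by arbitrary multiples
  of \<open>2 * g\<close>, with \<open>g\<close> the gcd of the \<open>e l\<close>. So a lift of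
  \<open>\<alpha> t\<close> exists as soon as \<open>\<delta> t\<close> is even, and the three
  \<open>\<delta> t\<close> have even sum.\<close>

lemma three_parities_lift:
  fixes e f :: "nat \<Rightarrow> int" and \<alpha> :: "nat \<Rightarrow> nat \<Rightarrow> int"
  assumes "\<And>l. l < s \<Longrightarrow> even (f l + \<alpha> 0 l + \<alpha> 1 l + \<alpha> 2 l)"
  shows "\<exists>t<3. \<exists>f'. (\<forall>l<s. even (f' l + \<alpha> t l)) \<and>
    (\<Sum>l<s. e l * f' l) = (\<Sum>l<s. e l * f l)"
proof -
  obtain g u where gu: "(\<Sum>l<s. e l * u l) = g" "\<And>l. l \<in> {..<s} \<Longrightarrow> g dvd e l"
    using int_bezout_family[of "{..<s}" e] by auto
  obtain e' where e': "\<And>l. l < s \<Longrightarrow> e l = g * e' l"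
    using gu(2) unfolding dvd_def by (metis lessThan_iff)
  define \<delta> where "\<delta> = (\<lambda>t. \<Sum>l<s. e' l * (f l - \<alpha> t l))"
  have "even (\<Sum>l<s. e' l * (f l - \<alpha> 0 l) + e' l * (f l - \<alpha> 1 l) + e' l * (f l - \<alpha> 2 l))"
  proof (rule dvd_sum)
    fix l assume "l \<in> {..<s}"
    then have "even (f l + \<alpha> 0 l + \<alpha> 1 l + \<alpha> 2 l)" using assms by simp
    then have "even (e' l * ((f l - \<alpha> 0 l) + (f l - \<alpha> 1 l) + (f l - \<alpha> 2 l)))" by auto
    then show "even (e' l * (f l - \<alpha> 0 l) + e' l * (f l - \<alpha> 1 l) + e' l * (f l - \<alpha> 2 l))"
      by (simp add: algebra_simps)
  qed
  then have "even (\<delta> 0 + \<delta> 1 + \<delta> 2)" by (simp add: \<delta>_def sum.distrib)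
  then have "even (\<delta> 0) \<or> even (\<delta> 1) \<or> even (\<delta> 2)" by auto
  then have "\<exists>t\<in>{0, 1, 2}. even (\<delta> t)" by auto
  moreover have "{0, 1, 2} \<subseteq> {..<3::nat}" by auto
  ultimately obtain t where "t < 3" "even (\<delta> t)" by blast
  then obtain h where t: "t < 3" "\<delta> t = 2 * h" by (auto elim: evenE)
  \<comment> \<open>The correction adds \<open>2 * h * g = g * \<delta> t\<close>, exactly the
    missing amount.\<close>
  define f' where "f' = (\<lambda>l. \<alpha> t l + 2 * h * u l)"
  have "(\<Sum>l<s. e l * \<alpha> t l) = (\<Sum>l<s. e l * f l) - g * \<delta> t"
    by (simp add: \<delta>_def e' sum_distrib_left algebra_simps flip: sum.distrib)
  moreover have "(\<Sum>l<s. e l * f' l) = (\<Sum>l<s. e l * \<alpha> t l) + 2 * h * (\<Sum>l<s. e l * u l)"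
    by (simp add: f'_def sum.distrib sum_distrib_left algebra_simps)
  ultimately have "(\<Sum>l<s. e l * f' l) = (\<Sum>l<s. e l * f l)"
    by (simp add: gu(1) t(2))
  moreover have "\<forall>l<s. even (f' l + \<alpha> t l)" by (simp add: f'_def)
  ultimately show ?thesis using t(1) by (intro exI[of _ t] exI[of _ f'] conjI)
qed

text \<open>One of the three sign characters lifts to an integer-valued assignment with the prescribed
  exponent sum; together with the translation coordinate it twists, this is a solution in the Klein
  bottle group.\<close>

lemma witness_verbally_closed: "verbally_closed witness_group (range witness_embedding)"
  unfolding verbally_closed_def
proof (intro conjI allI impI)
  show "subgroup (range witness_embedding) witness_group"
  proof -
    interpret group_hom klein_group witness_group witness_embedding
      by (simp add: group_hom_def group_hom_axioms_def klein_group_is_group witness_is_group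
          witness_embedding_hom)
    show ?thesis using img_is_subgroup by simp
  qed
next
  fix s w h
  assume "set (map fst w) \<subseteq> {..<s}" and "h \<in> range witness_embedding"
    and "\<exists>g. (\<forall>i<s. g i \<in> carrier witness_group) \<and> word_eval witness_group g w = h"
  then obtain g m n where w: "w \<in> words s" and h: "h = witness_embedding (m, n)"
    and g: "\<And>l. l < s \<Longrightarrow> g l \<in> carrier witness_group" "word_eval witness_group g w = h"
    by (auto simp: words_def)
  \<comment> \<open>The signs as bits; they sit at positions 3 to 5, after the three translation
    coordinates.\<close>
  define \<alpha> where "\<alpha> = (\<lambda>t l. if g l ! (3 + t) = 1 then 0 else 1 :: int)"
  have parity: "even (g l ! 6 + \<alpha> 0 l + \<alpha> 1 l + \<alpha> 2 l)" and sgn: "t < 3 \<Longrightarrow> g l ! (3 + t) \<in> {1, -1}"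
    if l: "l < s" for l t
  proof -
    obtain i j k p q r n where "g l = [i, j, k, p, q, r, n]"
      "p \<in> {1, -1}" "q \<in> {1, -1}" "r \<in> {1, -1}" "p * q * r = parity_sign n"
      using g(1)[OF l] by (rule witness_carrierE)
    then show "even (g l ! 6 + \<alpha> 0 l + \<alpha> 1 l + \<alpha> 2 l)"
      "t < 3 \<Longrightarrow> g l ! (3 + t) \<in> {1, -1}"
      by (auto simp: \<alpha>_def parity_sign_def numeral_eq_Suc less_Suc_eq split: if_splits)
  qed
  obtain t f' where t: "t < 3" and f': "\<And>l. l < s \<Longrightarrow> even (f' l + \<alpha> t l)"
    "(\<Sum>l<s. word_cross (\<lambda>_. 1) (unit_vec l) w * f' l) =
     (\<Sum>l<s. word_cross (\<lambda>_. 1) (unit_vec l) w * g l ! 6)"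
    using three_parities_lift[of s "\<lambda>l. g l ! 6" \<alpha> "\<lambda>l. word_cross (\<lambda>_. 1) (unit_vec l) w", OF parity]
    by auto
  have ev: "word_cross (\<lambda>l. g l ! 3) (\<lambda>l. g l ! 0) w = m" "word_cross (\<lambda>l. g l ! 4) (\<lambda>l. g l ! 1) w = m"
    "word_cross (\<lambda>l. g l ! 5) (\<lambda>l. g l ! 2) w = m" "word_cross (\<lambda>_. 1) (\<lambda>l. g l ! 6) w = n"
    using g(2) h word_eval_witness[of w s g, OF w g(1)] by (simp_all add: witness_embedding_def)
  define k where "k = (\<lambda>l. (g l ! t, f' l))"
  have "word_cross (\<lambda>l. parity_sign (f' l)) (\<lambda>l. g l ! t) w =
      word_cross (\<lambda>l. g l ! (3 + t)) (\<lambda>l. g l ! t) w"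
  proof (rule word_cross_cong[OF w])
    fix l assume l: "l < s"
    show "parity_sign (f' l) = g l ! (3 + t)"
      using sgn[OF l t] f'(1)[OF l] by (auto simp: \<alpha>_def parity_sign_def)
  qed simp
  also have "\<dots> = m"
    using t ev(1-3) by (auto simp: numeral_eq_Suc less_Suc_eq)
  finally have 1: "word_cross (\<lambda>l. parity_sign (f' l)) (\<lambda>l. g l ! t) w = m" .
  have "word_cross (\<lambda>_. 1) f' w = word_cross (\<lambda>_. 1) (\<lambda>l. g l ! 6) w"
    using f'(2) word_cross_linear[OF w, of "\<lambda>_. 1" f']
      word_cross_linear[OF w, of "\<lambda>_. 1" "\<lambda>l. g l ! 6"] by (simp add: mult.commute)
  also have "\<dots> = n" by (rule ev(4))
  finally have "word_eval klein_group k w = (m, n)"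
    using 1 by (simp add: word_eval_klein k_def)
  then have "word_eval witness_group (\<lambda>l. witness_embedding (k l)) w = h"
    using word_eval_hom[OF klein_group_is_group witness_is_group witness_embedding_hom w, of k] h
    by simp
  then show "\<exists>g. (\<forall>i<s. g i \<in> range witness_embedding) \<and> word_eval witness_group g w = h"
    by (intro exI[of _ "\<lambda>l. witness_embedding (k l)"]) simp
qed

text \<open>The second coordinate doubles, hence vanishes; without a twist the first one doubles as
  well.\<close>

lemma klein_square_one:
  assumes "y \<otimes>\<^bsub>klein_group\<^esub> y = (0, 0)"
  shows "y = (0, 0)"
  using assms by (cases y) (auto simp: klein_mult parity_sign_def)

text \<open>Every translation is inverted by an involution, and involutions die in the torsion-free
  Klein bottle group, so a homomorphism to it kills all translations.\<close>

lemma witness_not_retract: "\<not> is_retract witness_group (range witness_embedding)"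
proof
  assume "is_retract witness_group (range witness_embedding)"
  then obtain \<rho> where \<rho>: "\<rho> \<in> hom witness_group (witness_group\<lparr>carrier := range witness_embedding\<rparr>)"
    "\<And>y. \<rho> (witness_embedding y) = witness_embedding y"
    by (auto simp: is_retract_def)
  define \<psi> where "\<psi> = (\<lambda>u. inv_into UNIV witness_embedding (\<rho> u))"
  have emb: "witness_embedding (\<psi> u) = \<rho> u" if "u \<in> carrier witness_group" for u
    using \<rho>(1) that unfolding \<psi>_def hom_def by (auto intro!: f_inv_into_f)
  have mult: "\<psi> (u \<otimes>\<^bsub>witness_group\<^esub> v) = \<psi> u \<otimes>\<^bsub>klein_group\<^esub> \<psi> v"
    if "u \<in> carrier witness_group" "v \<in> carrier witness_group" for u v
  proof (rule injD[OF witness_embedding_inj])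
    have "u \<otimes>\<^bsub>witness_group\<^esub> v \<in> carrier witness_group"
      using group.is_monoid[OF witness_is_group] that by (rule monoid.m_closed)
    then show "witness_embedding (\<psi> (u \<otimes>\<^bsub>witness_group\<^esub> v)) =
        witness_embedding (\<psi> u \<otimes>\<^bsub>klein_group\<^esub> \<psi> v)"
      using \<rho>(1) that hom_mult[OF witness_embedding_hom] by (simp add: emb hom_def)
  qed
  have id: "\<psi> (witness_embedding y) = y" for y
    unfolding \<psi>_def \<rho>(2) by (rule inv_into_f_f[OF witness_embedding_inj]) simp
  have one: "\<psi> [0, 0, 0, 1, 1, 1, 0] = (0, 0)"
    using id[of "(0, 0)"] by (simp add: witness_embedding_def parity_sign_def)
  \<comment> \<open>The last two conditions say that \<open>z\<close> is an involution (or trivial)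
    inverting \<open>t\<close>. Since \<open>z\<close> dies, the image of \<open>t\<close> is its
    own inverse.\<close>
  have kill: "\<psi> t = (0, 0)"
    if "t \<in> carrier witness_group" "z \<in> carrier witness_group"
      "z \<otimes>\<^bsub>witness_group\<^esub> z = [0, 0, 0, 1, 1, 1, 0]"
      "t \<otimes>\<^bsub>witness_group\<^esub> z \<otimes>\<^bsub>witness_group\<^esub> t = z" for t z
  proof -
    have z: "\<psi> z = (0, 0)"
      by (rule klein_square_one) (use mult[OF that(2,2)] that(3) one in simp)
    have "t \<otimes>\<^bsub>witness_group\<^esub> z \<in> carrier witness_group"
      using group.is_monoid[OF witness_is_group] that(1,2) by (rule monoid.m_closed)
    then have "\<psi> t \<otimes>\<^bsub>klein_group\<^esub> (0, 0) \<otimes>\<^bsub>klein_group\<^esub> \<psi> t = (0, 0)"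
      using mult[of "t \<otimes>\<^bsub>witness_group\<^esub> z" t] mult[OF that(1,2)] that(1,4) z by simp
    then have "\<psi> t \<otimes>\<^bsub>klein_group\<^esub> \<psi> t = (0, 0)"
      by (cases "\<psi> t") (simp add: klein_mult)
    then show ?thesis by (rule klein_square_one)
  qed
  \<comment> \<open>For each axis an element with two negative signs is used, one of them on that
    axis.\<close>
  have t: "\<psi> [1, 0, 0, 1, 1, 1, 0] = (0, 0)" "\<psi> [0, 1, 0, 1, 1, 1, 0] = (0, 0)"
    "\<psi> [0, 0, 1, 1, 1, 1, 0] = (0, 0)"
    using kill[of "[1, 0, 0, 1, 1, 1, 0]" "[0, 0, 0, -1, -1, 1, 0]"]
      kill[of "[0, 1, 0, 1, 1, 1, 0]" "[0, 0, 0, -1, -1, 1, 0]"]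
      kill[of "[0, 0, 1, 1, 1, 1, 0]" "[0, 0, 0, -1, 1, -1, 0]"]
    by (simp_all add: witness_carrier witness_mult parity_sign_def)
  \<comment> \<open>The product of the three unit translations is the embedded \<open>a\<close>,
    which a retraction would have to fix.\<close>
  have "\<psi> ([1, 0, 0, 1, 1, 1, 0] \<otimes>\<^bsub>witness_group\<^esub>
      ([0, 1, 0, 1, 1, 1, 0] \<otimes>\<^bsub>witness_group\<^esub> [0, 0, 1, 1, 1, 1, 0])) = (0, 0)"
    using mult[of "[1, 0, 0, 1, 1, 1, 0]" "[0, 1, 1, 1, 1, 1, 0]"]
      mult[of "[0, 1, 0, 1, 1, 1, 0]" "[0, 0, 1, 1, 1, 1, 0]"] t
    by (simp add: witness_carrier witness_mult parity_sign_def klein_mult)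
  then show False
    using id[of "(1, 0)"] by (simp add: witness_embedding_def witness_mult parity_sign_def)
qed

section \<open>Choice of generators and assembly of both halves\<close>

lemma klein_verbally_closed_of_finitely_generated:
  fixes G (structure)
  assumes "group G" "finitely_generated G" "\<phi> \<in> hom klein_group G" "inj \<phi>"
    "verbally_closed G (range \<phi>)"
  shows "\<exists>x s. klein_verbally_closed G x s \<phi>"
proof -
  interpret group G by (rule assms(1))
  obtain S where S: "finite S" "S \<subseteq> carrier G" "generate G S = carrier G"
    using assms(2) by (auto simp: finitely_generated_def)
  obtain xs where xs: "set xs = S" using finite_list[OF S(1)] by blast
  define s where "s = length xs + 2"
  \<comment> \<open>The images of \<open>a\<close> and \<open>b\<close> are put in front of the
    given generators, hence the shift by 2.\<close>
  define x where "x = (\<lambda>i. if i = 0 then \<phi> (1, 0) else if i = 1 then \<phi> (0, 1) else xs ! (i - 2))"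
  have closed: "x i \<in> carrier G" if "i < s" for i
  proof (cases "i < 2")
    case True
    then show ?thesis using assms(3) by (auto simp: x_def hom_def)
  next
    case False
    then have "x i \<in> set xs" using that by (auto simp: x_def s_def)
    then show ?thesis using S(2) xs by blast
  qed
  have letter: "\<exists>i<s. x i = h" if h: "h \<in> S" for h
  proof -
    obtain j where "j < length xs" "xs ! j = h" using h xs by (metis in_set_conv_nth)
    then show ?thesis by (intro exI[of _ "j + 2"]) (simp add: s_def x_def)
  qed
  have "\<exists>w\<in>words s. word_eval G x w = g" if "g \<in> generate G S" for g
    using that
  proof (induction rule: generate.induct)
    case one
    show ?case by (rule bexI[of _ "[]"]) simp_all
  next
    case (incl h)
    then obtain i where "i < s" "x i = h" using letter by blast
    then show ?case using closed[of i] by (intro bexI[of _ "[(i, True)]"]) simp_all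
  next
    case (inv h)
    then obtain i where "i < s" "x i = h" using letter by blast
    then show ?case using closed[of i] by (intro bexI[of _ "[(i, False)]"]) simp_all
  next
    case (eng h1 h2)
    then obtain u v where "u \<in> words s" "word_eval G x u = h1" "v \<in> words s" "word_eval G x v = h2"
      by blast
    then show ?case
      using closed by (intro bexI[of _ "u @ v"]) (simp_all add: word_eval_append[of _ s])
  qed
  then have "klein_verbally_closed G x s \<phi>"
    by unfold_locales (use closed assms(3-5) S(3) in \<open>auto simp: x_def s_def\<close>)
  then show ?thesis by blast
qed

theorem mainTheorem1:
  shows "(\<exists>(G :: int list monoid) \<phi>.
            group G \<and> finitely_generated G \<and>
            \<phi> \<in> hom klein_group G \<and> inj_on \<phi> (carrier klein_group) \<and>
            verbally_closed G (\<phi> ` carrier klein_group) \<and>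
            \<not> is_retract G (\<phi> ` carrier klein_group))
       \<and> (\<forall>(G :: ('a, 'b) monoid_scheme) \<phi>.
            group G \<and> finitely_generated G \<and>
            \<phi> \<in> hom klein_group G \<and> inj_on \<phi> (carrier klein_group) \<and>
            verbally_closed G (\<phi> ` carrier klein_group) \<longrightarrow>
            (\<exists>L. subgroup L G \<and> \<phi> ` carrier klein_group \<subseteq> L \<and>
                 finite (rcosets\<^bsub>G\<^esub> L) \<and> card (rcosets\<^bsub>G\<^esub> L) \<le> 2 \<and>
                 is_retract (G\<lparr>carrier := L\<rparr>) (\<phi> ` carrier klein_group)))"
  unfolding klein_carrier
proof (intro conjI allI impI)
  show "\<exists>(G :: int list monoid) \<phi>. group G \<and> finitely_generated G \<and>
      \<phi> \<in> hom klein_group G \<and> inj \<phi> \<and> verbally_closed G (range \<phi>) \<and> \<not> is_retract G (range \<phi>)"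
    by (intro exI[of _ witness_group] exI[of _ witness_embedding] conjI witness_is_group
        witness_finitely_generated witness_embedding_hom witness_embedding_inj
        witness_verbally_closed witness_not_retract)
next
  fix G :: "('a, 'b) monoid_scheme" and \<phi>
  assume "group G \<and> finitely_generated G \<and> \<phi> \<in> hom klein_group G \<and> inj \<phi> \<and>
    verbally_closed G (range \<phi>)"
  then obtain x s where "klein_verbally_closed G x s \<phi>"
    using klein_verbally_closed_of_finitely_generated by blast
  then show "\<exists>L. subgroup L G \<and> range \<phi> \<subseteq> L \<and> finite (rcosets\<^bsub>G\<^esub> L) \<and>
      card (rcosets\<^bsub>G\<^esub> L) \<le> 2 \<and> is_retract (G\<lparr>carrier := L\<rparr>) (range \<phi>)"
    by (rule klein_verbally_closed.exists_retracting_subgroup)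
qed

end
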